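(* Let $X$ be a nonzero real Banach space. Then $\zeta_X=1$ if and only if either $X$ is a Euclidean space (i.e. the norm of $X$ is induced by an inner product, so that $X$ is a Hilbert space, of finite or infinite dimension) or $\dim X=2$.
   Context: For a real normed space $X$, $B_R(c)$ denotes the closed ball with center $c$ and radius $R>0$, $o$ is the origin, $\operatorname{co} D$ is the convex hull of $D$, and $\rho(x,A)=\inf_{a\in A}\|x-a\|$. The deviation of $A$ from $B$ is $h^{+}(A,B)=\sup_{x\in A}\rho(x,B)$. The CHD-constant (convex hull deviation constant) of $X$ is $\zeta_X=\sup h^{+}(\operatorname{co} D, D)$, where the supremum is over all nonempty sets $D\subset B_1(o)$. *)

theory Defs
  imports "HOL-Analysis.Analysis"
begin

text \<open>
  The suprema below are taken in \<^typ>\<open>real\<close>. Those entering the CHD-constant are over nonempty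
  families with upper bound 2 (lemmas \<open>deviation_bdd\<close> and \<open>chd_constant_bdd\<close>), so they are genuine
  least upper bounds; outside that use, \<open>deviation A B\<close> is only meaningful for nonempty \<open>A\<close>, \<open>B\<close>
  with the distances to \<open>B\<close> bounded on \<open>A\<close>.
\<close>

definition deviation :: "'a::real_normed_vector set \<Rightarrow> 'a set \<Rightarrow> real" where
  "deviation A B = (SUP x\<in>A. infdist x B)"

definition chd_constant :: "'a::real_normed_vector itself \<Rightarrow> real" where
  "chd_constant _ =
    (SUP D\<in>{D :: 'a set. D \<noteq> {} \<and> D \<subseteq> cball 0 1}. deviation (convex hull D) D)"

definition is_inner_product :: "('a::real_vector \<Rightarrow> 'a \<Rightarrow> real) \<Rightarrow> bool" where
  "is_inner_product ip \<longleftrightarrow>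
    bilinear ip \<and> (\<forall>x y. ip x y = ip y x) \<and> (\<forall>x. x \<noteq> 0 \<longrightarrow> ip x x > 0)"

definition norm_from_inner_product :: "'a::real_normed_vector itself \<Rightarrow> bool" where
  "norm_from_inner_product _ \<longleftrightarrow>
    (\<exists>ip :: 'a \<Rightarrow> 'a \<Rightarrow> real. is_inner_product ip \<and> (\<forall>x. norm x = sqrt (ip x x)))"

lemma infdist_convex_hull_le_2:
  fixes D :: "'a::real_normed_vector set"
  assumes "D \<noteq> {}" "D \<subseteq> cball 0 1" "x \<in> convex hull D"
  shows "infdist x D \<le> 2"
proof -
  obtain d where d: "d \<in> D" using assms(1) by blast
  have "convex hull D \<subseteq> cball 0 1"
    using assms(2) by (simp add: hull_minimal)
  then have "norm x \<le> 1" using assms(3) by auto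
  moreover have "norm d \<le> 1" using d assms(2) by auto
  ultimately have "dist x d \<le> 2"
    using norm_triangle_ineq4[of x d] by (simp add: dist_norm)
  then show ?thesis using infdist_le2[OF d] by blast
qed

lemma deviation_bdd:
  fixes D :: "'a::real_normed_vector set"
  assumes "D \<noteq> {}" "D \<subseteq> cball 0 1"
  shows "bdd_above ((\<lambda>x. infdist x D) ` (convex hull D))"
  using infdist_convex_hull_le_2[OF assms] by (intro bdd_aboveI2)

lemma chd_constant_bdd:
  "bdd_above ((\<lambda>D. deviation (convex hull D) D) `
     {D :: 'a::real_normed_vector set. D \<noteq> {} \<and> D \<subseteq> cball 0 1})"
proof (rule bdd_aboveI2)
  fix D :: "'a set"
  assume "D \<in> {D. D \<noteq> {} \<and> D \<subseteq> cball 0 1}"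
  then show "deviation (convex hull D) D \<le> 2"
    unfolding deviation_def
    by (intro cSUP_least infdist_convex_hull_le_2) auto
qed

end

theory Submission
  imports Defs
begin

text \<open>
  A pair of opposite unit vectors shows that the constant is at least 1 in every nonzero space, so
  the question is when it is at most 1. For an inner product norm, a convex combination
  \<open>z = (\<Sum>d. u d d)\<close> of points of the unit ball satisfies
  \<open>(\<Sum>d. u d \<bar>z - d\<bar>\<^sup>2) = (\<Sum>d. u d \<bar>d\<bar>\<^sup>2) - \<bar>z\<bar>\<^sup>2 \<le> 1\<close>, so some \<open>d\<close> is within distance 1 of \<open>z\<close>. In a plane,
  Caratheodory's theorem leaves only triangles; the cones spanned by two vertices of a triangle
  around the origin cover the plane, and inside one cone an explicit computation
  (\<open>cone_contraction\<close>) gives the bound.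

  Conversely, let the constant be 1 and the dimension not 1 or 2. Whether a norm is
  induced by an inner product is decided on triples of vectors, so it suffices to treat the
  three-dimensional subspaces, that is, norms \<open>N\<close> on a Euclidean space of dimension 3. The hypothesis now reads: if
  unit vectors surround the origin, no translation brings all of them into the open unit ball
  (\<open>sphere_escape\<close>). The proof that such an \<open>N\<close> is Euclidean has three stages.

  First, every plane \<open>H\<close> has a direction \<open>v\<close> outside \<open>H\<close> along which no vector of \<open>H\<close> can be
  shortened (\<open>orthogonal_complement_vector\<close>); equivalently, \<open>H\<close> is the range of a projection of
  norm 1. If every candidate \<open>v\<close> from a fixed translate of \<open>H\<close> shortened some unit vector of
  \<open>H\<close>, then averaging the shortened vectors would give a continuous map that contradicts Brouwer's theorem, because
  the hypothesis keeps the average away from 0.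

  Secondly, let \<open>b\<close> be a unit vector at which a Euclidean ball touches the unit sphere from inside;
  such points are dense (\<open>touching_ball\<close>). All directions \<open>v\<close> that belong to planes
  through \<open>b\<close> then lie in one tangent plane \<open>V\<close>. Hence the level curves of \<open>x \<mapsto> N (b + x)\<close> on \<open>V\<close>
  have at every point the same supporting direction as the circle of \<open>N\<close> through that point, and
  are therefore homothetic to it (\<open>level_curves_homothetic\<close>). In particular \<open>N (b + x) = N (b - x)\<close>
  on \<open>V\<close>: the linear reflection that fixes \<open>b\<close> and negates \<open>V\<close> is an isometry. By compactness such
  a reflection exists at every unit vector (\<open>reflection_exists\<close>).

  Finally, write the reflection at \<open>a\<close> as \<open>x \<mapsto> 2 (F a \<bullet> x) a - x\<close>. It is determined by \<open>a\<close>, so \<open>F\<close> is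
  continuous, and the intermediate value theorem yields a reflection that swaps two given unit
  vectors (\<open>swap_isometry\<close>). Uniqueness transports \<open>F x\<close> to \<open>F y\<close> under this swap, which gives
  \<open>F x \<bullet> y = F y \<bullet> x\<close>. So the form \<open>N x (F (x / N x) \<bullet> y)\<close>, linear in \<open>y\<close> by construction, is symmetric
  and hence an inner product that induces \<open>N\<close>. The last two stages together prove the theorem of
  Blaschke and Kakutani: a norm on a three-dimensional space is Euclidean if every plane is the
  range of a projection of norm 1.
\<close>

section \<open>The constant is at least 1\<close>

lemma infdist_le_chd_constant:
  fixes D :: "'a::real_normed_vector set"
  assumes "D \<noteq> {}" "D \<subseteq> cball 0 1" "z \<in> convex hull D"
  shows "infdist z D \<le> chd_constant TYPE('a)"
proof -
  have "infdist z D \<le> deviation (convex hull D) D"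
    unfolding deviation_def using deviation_bdd[OF assms(1,2)] assms(3) by (intro cSUP_upper)
  also have "\<dots> \<le> chd_constant TYPE('a)"
    unfolding chd_constant_def by (rule cSUP_upper) (use assms chd_constant_bdd in auto)
  finally show ?thesis .
qed

lemma infdist_le_near:
  assumes "d \<in> D" "norm (z - d) \<le> r"
  shows "infdist z D \<le> r"
  using infdist_le2[of d D z r] assms by (simp add: dist_norm)

lemma chd_constant_leI:
  assumes "\<And>(D :: 'a::real_normed_vector set) z.
    \<lbrakk>D \<noteq> {}; D \<subseteq> cball 0 1; z \<in> convex hull D\<rbrakk> \<Longrightarrow> \<exists>d\<in>D. norm (z - d) \<le> r"
  shows "chd_constant TYPE('a) \<le> r"
  unfolding chd_constant_def
proof (rule cSUP_least)
  show "{D :: 'a set. D \<noteq> {} \<and> D \<subseteq> cball 0 1} \<noteq> {}" by (auto intro!: exI[of _ "{0}"])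
  fix D :: "'a set" assume "D \<in> {D. D \<noteq> {} \<and> D \<subseteq> cball 0 1}"
  then have D: "D \<noteq> {}" "D \<subseteq> cball 0 1" by auto
  show "deviation (convex hull D) D \<le> r"
    unfolding deviation_def
  proof (rule cSUP_least)
    show "convex hull D \<noteq> {}" using D by simp
    show "infdist z D \<le> r" if "z \<in> convex hull D" for z
      using assms[OF D that] infdist_le_near by (elim bexE)
  qed
qed

lemma chd_constant_ge_1:
  assumes "(UNIV :: 'a::real_normed_vector set) \<noteq> {0}"
  shows "1 \<le> chd_constant TYPE('a)"
proof -
  obtain y :: 'a where "y \<noteq> 0" using assms by blast
  then obtain x :: 'a where x: "norm x = 1" using norm_sgn[of y] by auto
  have "(1/2) *\<^sub>R x + (1/2) *\<^sub>R (- x) \<in> convex hull {x, - x}"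
    by (rule convexD[OF convex_convex_hull]) (auto simp: hull_inc)
  then have "infdist 0 {x, - x} \<le> chd_constant TYPE('a)"
    using x by (intro infdist_le_chd_constant) auto
  moreover have "1 \<le> infdist 0 {x, - x}"
    unfolding infdist_def using x by (auto intro!: cINF_greatest)
  ultimately show ?thesis by simp
qed

section \<open>Inner product norms\<close>

text \<open>
  The mean of \<open>\<bar>z - d\<bar>\<^sup>2\<close> with the weights of a convex combination equal to \<open>z\<close> is the variance of the points,
  which is at most the mean of \<open>\<bar>d\<bar>\<^sup>2\<close>; a mean at most 1 has a term at most 1.
\<close>
lemma chd_constant_euclidean:
  assumes "norm_from_inner_product TYPE('a::real_normed_vector)"
  shows "chd_constant TYPE('a) \<le> 1"
proof (rule chd_constant_leI)
  fix D :: "'a set" and z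
  assume D: "D \<subseteq> cball 0 1" "z \<in> convex hull D"
  obtain ip :: "'a \<Rightarrow> 'a \<Rightarrow> real" where bil: "bilinear ip" and sym: "\<And>x y. ip x y = ip y x"
    and pos: "\<And>x. x \<noteq> 0 \<Longrightarrow> ip x x > 0" and nrm: "\<And>x. norm x = sqrt (ip x x)"
    using assms by (auto simp: norm_from_inner_product_def is_inner_product_def)
  have ge0: "ip x x \<ge> 0" for x using pos[of x] bil by (cases "x = 0") (auto simp: bilinear_lzero)
  have nrm2: "ip x x = (norm x)\<^sup>2" for x using ge0 by (simp add: nrm)
  obtain S u where S: "finite S" "S \<subseteq> D" "\<forall>x\<in>S. 0 \<le> u x" "sum u S = 1" "(\<Sum>v\<in>S. u v *\<^sub>R v) = z"
    using D(2) unfolding convex_hull_explicit by auto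
  show "\<exists>d\<in>D. norm (z - d) \<le> 1"
  proof (rule ccontr)
    assume "\<not> ?thesis"
    then have far: "norm (z - d) > 1" if "d \<in> S" for d using that S(2) by force
    have expand: "ip (z - d) (z - d) = ip z z - 2 * ip d z + ip d d" for d
      using bil sym[of z d] by (simp add: bilinear_lsub bilinear_rsub)
    have lin: "linear (\<lambda>x. ip x z)" using bil by (simp add: bilinear_def)
    have lin_z: "(\<Sum>d\<in>S. u d * ip d z) = ip z z"
      using linear_sum[OF lin, of "\<lambda>v. u v *\<^sub>R v" S] linear_cmul[OF lin] by (simp add: S(5))
    have "(\<Sum>d\<in>S. u d * (2 * ip d z)) = 2 * ip z z"
      unfolding lin_z[symmetric] by (subst sum_distrib_left) (rule sum.cong; simp)
    then have "(\<Sum>d\<in>S. u d * ip (z - d) (z - d)) = (\<Sum>d\<in>S. u d * ip d d) - ip z z"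
      unfolding expand distrib_left right_diff_distrib sum.distrib sum_subtractf
      using S(4) by (simp flip: sum_distrib_right)
    also have "(\<Sum>d\<in>S. u d * ip d d) \<le> (\<Sum>d\<in>S. u d)"
    proof (rule sum_mono)
      fix d assume d: "d \<in> S"
      then have "norm d \<le> 1" using S(2) D(1) by auto
      then have "ip d d \<le> 1" unfolding nrm2 by (simp add: abs_square_le_1)
      then show "u d * ip d d \<le> u d" using S(3) d by (simp add: mult_left_le)
    qed
    finally have le: "(\<Sum>d\<in>S. u d * ip (z - d) (z - d)) \<le> 1" using S(4) ge0[of z] by simp
    obtain e where e: "e \<in> S" "u e > 0"
      using S(3,4) by (metis less_eq_real_def sum.neutral zero_neq_one)
    have "(\<Sum>d\<in>S. u d) < (\<Sum>d\<in>S. u d * ip (z - d) (z - d))"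
    proof (rule sum_strict_mono_ex1[OF S(1)])
      have big: "ip (z - d) (z - d) > 1" if "d \<in> S" for d
        using far[OF that] unfolding nrm2 by simp
      show "\<forall>d\<in>S. u d \<le> u d * ip (z - d) (z - d)"
        using big S(3) by (metis less_imp_le mult.right_neutral mult_left_mono)
      show "\<exists>d\<in>S. u d < u d * ip (z - d) (z - d)"
        using big e by (metis mult.right_neutral mult_strict_left_mono)
    qed
    then show False using le S(4) by simp
  qed
qed

section \<open>Planes\<close>

lemma independent_pair:
  assumes "x \<noteq> 0" "\<And>k. y \<noteq> k *\<^sub>R x"
  shows "independent {x, y}" "x \<noteq> y"
proof -
  show ne: "x \<noteq> y" using assms(2)[of 1] by simp
  have "independent (insert y {x})"
    using assms ne unfolding independent_insert by (auto simp: span_singleton independent_empty)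
  then show "independent {x, y}" by (simp add: insert_commute)
qed

text \<open>
  The two translated vectors determine \<open>a\<close> and \<open>b\<close>. Solving the linear system for the vector with the
  larger coefficient expresses it with coefficients of total absolute value at most 1.
\<close>
lemma cone_contraction:
  fixes a b :: "'a::real_normed_vector"
  assumes "0 \<le> \<alpha>" "0 \<le> \<beta>" "norm (a + (\<alpha> *\<^sub>R a + \<beta> *\<^sub>R b)) \<le> 1" "norm (b + (\<alpha> *\<^sub>R a + \<beta> *\<^sub>R b)) \<le> 1"
  shows "norm a \<le> 1 \<or> norm b \<le> 1"
proof -
  have *: "norm a \<le> 1" if "0 \<le> \<alpha>" "0 \<le> \<beta>" "\<beta> \<le> \<alpha>" "norm (a + (\<alpha> *\<^sub>R a + \<beta> *\<^sub>R b)) \<le> 1"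
    "norm (b + (\<alpha> *\<^sub>R a + \<beta> *\<^sub>R b)) \<le> 1" for a b :: 'a and \<alpha> \<beta> :: real
  proof -
    define p q where "p = a + (\<alpha> *\<^sub>R a + \<beta> *\<^sub>R b)" and "q = b + (\<alpha> *\<^sub>R a + \<beta> *\<^sub>R b)"
    have "(1 + \<alpha> + \<beta>) *\<^sub>R a = (1 + \<beta>) *\<^sub>R p - \<beta> *\<^sub>R q"
      by (simp add: p_def q_def algebra_simps)
    then have "norm ((1 + \<alpha> + \<beta>) *\<^sub>R a) \<le> norm ((1 + \<beta>) *\<^sub>R p) + norm (\<beta> *\<^sub>R q)"
      by (metis norm_triangle_ineq4)
    also have "\<dots> \<le> (1 + \<beta>) * 1 + \<beta> * 1"
      using that(2,4,5) unfolding p_def[symmetric] q_def[symmetric]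
      by (intro add_mono) (simp_all add: mult_left_le)
    also have "\<dots> \<le> (1 + \<alpha> + \<beta>) * 1" using that(3) by simp
    finally show ?thesis using that by simp
  qed
  show ?thesis
  proof (cases "\<beta> \<le> \<alpha>")
    case True then show ?thesis using *[of \<alpha> \<beta> a b] assms by simp
  next
    case False then show ?thesis using *[of \<beta> \<alpha> b a] assms by (simp add: add.commute)
  qed
qed

text \<open>
  A multiple of the positive relation between \<open>a\<close>, \<open>b\<close> and \<open>c\<close> can be added to any representation of \<open>p\<close>;
  take the smallest one that makes all coefficients nonnegative, so that one of them vanishes.
\<close>
lemma cone_cover:
  fixes a b c :: "'a::real_vector"
  assumes "0 < u" "0 < v" "0 < w" "u *\<^sub>R a + v *\<^sub>R b + w *\<^sub>R c = 0" and p: "p = \<alpha> *\<^sub>R a + \<beta> *\<^sub>R b"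
  shows "\<exists>\<alpha>\<ge>0. \<exists>\<beta>\<ge>0. p = \<alpha> *\<^sub>R a + \<beta> *\<^sub>R b \<or> p = \<alpha> *\<^sub>R b + \<beta> *\<^sub>R c \<or> p = \<alpha> *\<^sub>R a + \<beta> *\<^sub>R c"
proof -
  define t where "t = max 0 (max (- \<alpha> / u) (- \<beta> / v))"
  have t: "0 \<le> t" "0 \<le> \<alpha> + t * u" "0 \<le> \<beta> + t * v"
    and zero: "t = 0 \<or> \<alpha> + t * u = 0 \<or> \<beta> + t * v = 0"
  proof -
    show "0 \<le> t" by (simp add: t_def)
    have "- \<alpha> / u \<le> t" "- \<beta> / v \<le> t" by (auto simp: t_def)
    then show "0 \<le> \<alpha> + t * u" "0 \<le> \<beta> + t * v" using assms(1,2) by (auto simp: field_simps)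
    show "t = 0 \<or> \<alpha> + t * u = 0 \<or> \<beta> + t * v = 0"
      using assms(1,2) by (auto simp: t_def max_def)
  qed
  have "p = p + t *\<^sub>R (u *\<^sub>R a + v *\<^sub>R b + w *\<^sub>R c)" using assms(4) by simp
  also have "\<dots> = (\<alpha> + t * u) *\<^sub>R a + (\<beta> + t * v) *\<^sub>R b + (t * w) *\<^sub>R c"
    by (simp add: p algebra_simps)
  finally have eq: "p = (\<alpha> + t * u) *\<^sub>R a + (\<beta> + t * v) *\<^sub>R b + (t * w) *\<^sub>R c" .
  have tw: "0 \<le> t * w" using t(1) assms(3) by simp
  from zero show ?thesis
  proof (elim disjE)
    assume "t = 0"
    then show ?thesis using eq t by auto
  next
    assume "\<alpha> + t * u = 0"
    then have "p = (\<beta> + t * v) *\<^sub>R b + (t * w) *\<^sub>R c" using eq by simp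
    then show ?thesis using t(3) tw by blast
  next
    assume "\<beta> + t * v = 0"
    then have "p = (\<alpha> + t * u) *\<^sub>R a + (t * w) *\<^sub>R c" using eq by simp
    then show ?thesis using t(2) tw by blast
  qed
qed

text \<open>
  Suppose that all three vertices have norm greater than 1. If \<open>p\<close> lies in one of the three cones,
  \<open>cone_contraction\<close> applies to the two vertices of that cone. What remains are degenerate triangles, with the
  origin on a segment between two vertices: these are too far apart to fit into a ball of radius 1.
\<close>
lemma surrounding_triangle:
  fixes a b c p :: "'a::real_normed_vector"
  assumes plane: "\<And>x y :: 'a. \<lbrakk>independent {x, y}; x \<noteq> y\<rbrakk> \<Longrightarrow> span {x, y} = UNIV"
    and uvw: "0 \<le> u" "0 \<le> v" "0 \<le> w" "u + v + w = 1" "u *\<^sub>R a + v *\<^sub>R b + w *\<^sub>R c = 0"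
    and near: "norm (a + p) \<le> 1" "norm (b + p) \<le> 1" "norm (c + p) \<le> 1"
  shows "norm a \<le> 1 \<or> norm b \<le> 1 \<or> norm c \<le> 1"
proof (rule ccontr)
  assume "\<not> ?thesis"
  then have big: "norm a > 1" "norm b > 1" "norm c > 1" by auto
  \<comment> \<open>two points of the translated unit ball are at distance at most 2\<close>
  have opposite: False if "norm (x + p) \<le> 1" "norm (y + p) \<le> 1" "norm x > 1" "norm y > 1"
    "r *\<^sub>R x + s *\<^sub>R y = 0" "0 \<le> r" "0 \<le> s" "r + s > 0" for x y r s
  proof -
    have "norm x + norm y \<le> norm (x - y)"
    proof -
      have ne: "x \<noteq> 0" "y \<noteq> 0" using that by auto
      have eq: "r *\<^sub>R x = - (s *\<^sub>R y)" using that(5) by (simp add: add_eq_0_iff2)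
      have r: "r > 0" "s > 0" using that(6-8) eq ne by (auto simp: less_le)
      have "r *\<^sub>R (x - y) = - ((r + s) *\<^sub>R y)" using eq by (simp add: algebra_simps)
      then have "norm (r *\<^sub>R (x - y)) = norm ((r + s) *\<^sub>R y)" by simp
      then have "r * norm (x - y) = (r + s) * norm y" using r by simp
      also have "\<dots> = r * norm y + s * norm y" by (simp add: algebra_simps)
      also have "s * norm y = r * norm x"
        using arg_cong[OF eq, of norm] r by simp
      finally have "r * norm (x - y) = r * (norm x + norm y)" by (simp add: algebra_simps)
      then show ?thesis using r by simp
    qed
    moreover have "norm (x - y) \<le> 2"
      using norm_triangle_ineq4[of "x + p" "y + p"] that by simp
    ultimately show False using that by simp
  qed
  consider "u = 0" | "v = 0" | "w = 0" | "u > 0" "v > 0" "w > 0" using uvw by force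
  then show False
  proof cases
    case 1 then show False using opposite[of b c v w] uvw near big by auto
  next
    case 2 then show False using opposite[of a c u w] uvw near big by auto
  next
    case 3 then show False using opposite[of a b u v] uvw near big by auto
  next
    case 4
    show False
    proof (cases "\<exists>k. b = k *\<^sub>R a")
      case True
      then obtain k where k: "b = k *\<^sub>R a" by blast
      show False
      proof (cases "k \<le> 0")
        case True
        then show False using opposite[of a b "- k" 1] k near big by simp
      next
        case False
        have "(u + v * k) *\<^sub>R a + w *\<^sub>R c = 0" using uvw(5) by (simp add: k algebra_simps)
        moreover have "u + v * k > 0" using 4 False by (simp add: add_pos_pos)
        ultimately show False using opposite[of a c "u + v * k" w] 4 near big by simp
      qed
    next
      case False
      have "a \<noteq> 0" using big by auto
      then have "span {a, b} = UNIV" using plane independent_pair[of a b] False by blast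
      then obtain \<alpha> \<beta> where "p = \<alpha> *\<^sub>R a + \<beta> *\<^sub>R b"
        by (auto simp: span_insert span_singleton set_eq_iff algebra_simps) metis
      from cone_cover[OF 4 uvw(5) this] obtain \<alpha> \<beta> where ab: "0 \<le> \<alpha>" "0 \<le> \<beta>"
        "p = \<alpha> *\<^sub>R a + \<beta> *\<^sub>R b \<or> p = \<alpha> *\<^sub>R b + \<beta> *\<^sub>R c \<or> p = \<alpha> *\<^sub>R a + \<beta> *\<^sub>R c" by blast
      then show False
        using cone_contraction[OF ab(1,2), of a b] cone_contraction[OF ab(1,2), of b c]
          cone_contraction[OF ab(1,2), of a c] near big by fastforce
    qed
  qed
qed

lemma chd_constant_plane:
  assumes "dim (UNIV :: 'a::real_normed_vector set) = 2"
  shows "chd_constant TYPE('a) \<le> 1"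
proof (rule chd_constant_leI)
  fix D :: "'a set" and z
  assume D: "D \<noteq> {}" "D \<subseteq> cball 0 1" "z \<in> convex hull D"
  obtain B :: "'a set" where B: "independent B" "span B = UNIV" "card B = 2"
    using basis_exists[of "UNIV :: 'a set"] assms by (metis UNIV_I subsetI subset_antisym)
  then obtain e1 e2 where e: "B = {e1, e2}" by (metis card_2_iff)
  have plane: "span {x, y} = UNIV" if "independent {x, y}" "x \<noteq> y" for x y :: 'a
  proof (rule ccontr)
    assume "span {x, y} \<noteq> UNIV"
    then obtain t where t: "t \<notin> span {x, y}" by blast
    have "independent (insert t {x, y})" using t that(1) by (rule independent_insertI)
    then have "card (insert t {x, y}) \<le> card B"
      using independent_span_bound[of B "insert t {x, y}"] B by (simp add: e)
    moreover have "t \<noteq> x" "t \<noteq> y" using t by (auto simp: span_base)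
    ultimately show False using that(2) B by simp
  qed
  \<comment> \<open>coordinates in the complex plane make Caratheodory's theorem for Euclidean spaces applicable\<close>
  define \<phi> where "\<phi> z = Re z *\<^sub>R e1 + Im z *\<^sub>R e2" for z
  have \<phi>: "linear \<phi>" by (rule linearI) (auto simp: \<phi>_def algebra_simps)
  have surj: "surj \<phi>"
  proof (unfold surj_def, rule allI)
    fix x
    have "x \<in> span {e1, e2}" using B e by simp
    then obtain \<alpha> \<beta> where "x = \<alpha> *\<^sub>R e1 + \<beta> *\<^sub>R e2"
      by (auto simp: span_insert span_singleton algebra_simps)
    then show "\<exists>z. x = \<phi> z" by (intro exI[of _ "Complex \<alpha> \<beta>"]) (simp add: \<phi>_def)
  qed
  have "\<phi> ` (convex hull (\<phi> -` D)) = convex hull D"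
    using convex_hull_linear_image[OF \<phi>, of "\<phi> -` D"] surj by (simp add: surj_image_vimage_eq)
  then obtain \<zeta> where \<zeta>: "\<zeta> \<in> convex hull (\<phi> -` D)" "z = \<phi> \<zeta>" using D(3) by blast
  then obtain T where T: "finite T" "T \<subseteq> \<phi> -` D" "card T \<le> 3" "\<zeta> \<in> convex hull T"
    unfolding caratheodory[of "\<phi> -` D"] by auto
  have "T \<noteq> {}" using T(4) by auto
  have "\<exists>a b c. T = {a, b, c}"
  proof -
    have "card T = 1 \<or> card T = 2 \<or> card T = 3"
      using T(1,3) \<open>T \<noteq> {}\<close> card_gt_0_iff[of T] by linarith
    then show ?thesis by (metis card_1_singletonE card_2_iff card_3_iff insert_absorb2)
  qed
  then obtain a b c where "T = {a, b, c}" by blast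
  then have "z \<in> convex hull {\<phi> a, \<phi> b, \<phi> c}" and abc: "\<phi> a \<in> D" "\<phi> b \<in> D" "\<phi> c \<in> D"
    using T(2,4) \<zeta>(2) convex_hull_linear_image[OF \<phi>, of T] by auto
  then obtain u v w where uvw: "0 \<le> u" "0 \<le> v" "0 \<le> w" "u + v + w = 1"
    "z = u *\<^sub>R \<phi> a + v *\<^sub>R \<phi> b + w *\<^sub>R \<phi> c"
    unfolding convex_hull_3 by blast
  have "u *\<^sub>R (\<phi> a - z) + v *\<^sub>R (\<phi> b - z) + w *\<^sub>R (\<phi> c - z) = z - (u + v + w) *\<^sub>R z"
    by (simp add: algebra_simps uvw(5)[symmetric])
      (simp add: uvw(5) algebra_simps)
  then have sum0: "u *\<^sub>R (\<phi> a - z) + v *\<^sub>R (\<phi> b - z) + w *\<^sub>R (\<phi> c - z) = 0" using uvw(4) by simp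
  have ball: "norm (\<phi> a - z + z) \<le> 1" "norm (\<phi> b - z + z) \<le> 1" "norm (\<phi> c - z + z) \<le> 1"
    using abc D(2) by auto
  from surrounding_triangle[OF plane uvw(1-4) sum0 ball] show "\<exists>d\<in>D. norm (z - d) \<le> 1"
    using abc by (metis norm_minus_commute)
qed

section \<open>Norms on a Euclidean space\<close>

text \<open>
  A second norm on a Euclidean space, given as a function: Brouwer's theorem, nearest points and
  orthogonal complements need the Euclidean structure, and all convexity arguments concern \<open>N\<close>.
\<close>
locale norm_function =
  fixes N :: "'e::euclidean_space \<Rightarrow> real"
  assumes triangle: "N (x + y) \<le> N x + N y"
    and scale: "N (c *\<^sub>R x) = \<bar>c\<bar> * N x"
    and pos: "x \<noteq> 0 \<Longrightarrow> 0 < N x"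
begin

lemma N_zero [simp]: "N 0 = 0"
  using scale[of 0 0] by simp

lemma N_minus [simp]: "N (- x) = N x"
  using scale[of "-1" x] by simp

lemma N_nonneg [simp]: "0 \<le> N x"
  using pos[of x] by (cases "x = 0") auto

lemma N_eq_0_iff [simp]: "N x = 0 \<longleftrightarrow> x = 0"
  using pos[of x] by (cases "x = 0") auto

lemma N_triangle_diff: "N x - N y \<le> N (x - y)"
  using triangle[of "x - y" y] by simp

lemma N_diff_le: "N (x - y) \<le> N x + N y"
  using triangle[of x "- y"] by simp

lemma N_normalize: "x \<noteq> 0 \<Longrightarrow> N ((1 / N x) *\<^sub>R x) = 1"
  by (simp add: scale)

lemma continuous_on_N: "continuous_on S N"
proof -
  have "convex_on UNIV N"
  proof (rule convex_onI)
    fix t x y assume "0 < t" "t < (1::real)"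
    then show "N ((1 - t) *\<^sub>R x + t *\<^sub>R y) \<le> (1 - t) * N x + t * N y"
      using triangle[of "(1 - t) *\<^sub>R x" "t *\<^sub>R y"] by (simp add: scale)
  qed auto
  then have "continuous_on UNIV N"
    using convex_on_continuous open_UNIV by blast
  then show ?thesis by (rule continuous_on_subset) simp
qed

lemma continuous_on_N_compose [continuous_intros]:
  "continuous_on S f \<Longrightarrow> continuous_on S (\<lambda>x. N (f x))"
  using continuous_on_compose2[OF continuous_on_N, of S f UNIV] by auto

lemma tendsto_N [tendsto_intros]: "(f \<longlongrightarrow> l) F \<Longrightarrow> ((\<lambda>x. N (f x)) \<longlongrightarrow> N l) F"
  by (rule continuous_on_tendsto_compose[OF continuous_on_N[of UNIV]]) auto

lemma norm_le_N: "\<exists>m>0. \<forall>x. m * norm x \<le> N x"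
proof -
  have "sphere (0::'e) 1 \<noteq> {}" by simp
  then obtain e where e: "e \<in> sphere 0 1" "\<And>x. x \<in> sphere 0 1 \<Longrightarrow> N e \<le> N x"
    using continuous_attains_inf[OF compact_sphere _ continuous_on_N] by metis
  have "N e * norm x \<le> N x" for x
  proof (cases "x = 0")
    case False
    then have "N e \<le> N ((1 / norm x) *\<^sub>R x)" by (intro e) simp
    then show ?thesis using False by (simp add: scale field_simps)
  qed simp
  moreover have "N e > 0" using e(1) by (intro pos) auto
  ultimately show ?thesis by blast
qed

lemma N_le_norm: "\<exists>C>0. \<forall>x. N x \<le> C * norm x"
proof -
  have "sphere (0::'e) 1 \<noteq> {}" by simp
  then obtain e where e: "e \<in> sphere 0 1" "\<And>x. x \<in> sphere 0 1 \<Longrightarrow> N x \<le> N e"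
    using continuous_attains_sup[OF compact_sphere _ continuous_on_N] by metis
  have "N x \<le> N e * norm x" for x
  proof (cases "x = 0")
    case False
    then have "N ((1 / norm x) *\<^sub>R x) \<le> N e" by (intro e) simp
    then show ?thesis using False by (simp add: scale field_simps)
  qed simp
  moreover have "N e > 0" using e(1) by (intro pos) auto
  ultimately show ?thesis by blast
qed

text \<open>
  A reflection at \<open>a\<close> satisfies \<open>2 (F \<bullet> x) a = (2 (F \<bullet> x) a - x) + x\<close>, where both summands have norm \<open>N x\<close>; so
  \<open>\<bar>F \<bullet> x\<bar> \<le> N x\<close>, and \<open>x = F\<close> bounds \<open>F\<close>.
\<close>
lemma reflection_functional_bound:
  "\<exists>C. \<forall>a F. N a = 1 \<longrightarrow> (\<forall>x. N ((2 * (F \<bullet> x)) *\<^sub>R a - x) = N x) \<longrightarrow> norm F \<le> C"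
proof -
  obtain C where C: "C > 0" "\<And>x. N x \<le> C * norm x" using N_le_norm by blast
  have "norm F \<le> C" if a: "N a = 1" and iso: "\<And>x. N ((2 * (F \<bullet> x)) *\<^sub>R a - x) = N x" for a F
  proof -
    have "N ((2 * (F \<bullet> F)) *\<^sub>R a) \<le> 2 * N F"
      using triangle[of "(2 * (F \<bullet> F)) *\<^sub>R a - F" F] iso[of F] by simp
    then have "F \<bullet> F \<le> C * norm F" using a C(2)[of F] by (simp add: scale)
    then have "norm F * norm F \<le> C * norm F"
      by (metis dot_square_norm power2_eq_square)
    then show ?thesis using C(1) by (cases "F = 0") (auto simp: mult_le_cancel_right)
  qed
  then show ?thesis by blast
qed

lemma compact_N_ball: "compact {x. N x \<le> r}"
proof -
  obtain m where m: "m > 0" "\<And>x. m * norm x \<le> N x" using norm_le_N by blast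
  have "norm x \<le> r / m" if "N x \<le> r" for x
    using m(2)[of x] that m(1) by (simp add: field_simps)
  then have "bounded {x. N x \<le> r}" by (auto simp: bounded_iff)
  moreover have "closed {x. N x \<le> r}"
    by (intro closed_Collect_le continuous_intros)
  ultimately show ?thesis by (simp add: compact_eq_bounded_closed)
qed

lemma convex_N_ball: "convex {x. N x \<le> r}"
proof (rule convexI)
  fix x y u v assume *: "x \<in> {x. N x \<le> r}" "y \<in> {x. N x \<le> r}" "0 \<le> u" "0 \<le> v" "u + v = (1::real)"
  have "N (u *\<^sub>R x + v *\<^sub>R y) \<le> u * N x + v * N y"
    using triangle[of "u *\<^sub>R x" "v *\<^sub>R y"] * by (simp add: scale)
  also have "\<dots> \<le> u * r + v * r"
    using * by (intro add_mono mult_left_mono) auto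
  also have "\<dots> = r" using * by (simp flip: distrib_right)
  finally show "u *\<^sub>R x + v *\<^sub>R y \<in> {x. N x \<le> r}" by simp
qed

end

section \<open>Orthogonal directions to subspaces, from the convex hull condition\<close>

text \<open>
  The form in which the bound on the convex hull deviation is used: a translation has moved the
  deviating point of the hull to the origin, and \<open>w\<close> is the centre of the ball that contains \<open>A\<close>.
\<close>
locale chd_norm = norm_function N for N :: "'e::euclidean_space \<Rightarrow> real" +
  assumes sphere_escape:
    "\<lbrakk>finite A; 0 \<in> convex hull A; \<forall>a\<in>A. N a = 1\<rbrakk> \<Longrightarrow> \<exists>a\<in>A. 1 \<le> N (a - w)"
begin

text \<open>
  Otherwise each \<open>h\<close> in the ball of \<open>H\<close> with radius \<open>2 N v0\<close> has unit vectors \<open>a\<close> in \<open>H\<close> that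
  are shortened by subtracting \<open>t (h + v0)\<close>. Finitely many \<open>a\<close> serve all \<open>h\<close>, by compactness. Let \<open>M h\<close> be their average, weighted by the amount by which
  they are shortened. By \<open>sphere_escape\<close> it is never 0, so \<open>- M h\<close>, scaled to the boundary, is a continuous
  self-map of the ball. At a fixed point, \<open>h\<close> is opposite to \<open>M h\<close>; but \<open>h\<close> is long compared with \<open>v0\<close>, so the
  unit vector in the direction of \<open>h\<close> is itself shortened, and together with the vectors averaged by
  \<open>M h\<close> it surrounds the origin.
\<close>
lemma approx_orthogonal:
  assumes H: "subspace H" and v0: "v0 \<noteq> 0" and t: "0 < t" "t * (2 * N v0) \<le> 1"
  shows "\<exists>h\<in>H. N h \<le> 2 * N v0 \<and> (\<forall>a\<in>H. N a = 1 \<longrightarrow> 1 \<le> N (a - t *\<^sub>R (h + v0)))"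
proof (rule ccontr)
  define R where "R = 2 * N v0"
  define K where "K = H \<inter> {h. N h \<le> R}"
  assume "\<not> ?thesis"
  then have near: "\<exists>a\<in>H. N a = 1 \<and> N (a - t *\<^sub>R (h + v0)) < 1" if "h \<in> K" for h
    using that by (force simp: K_def R_def)
  have R: "R > 0" using pos[OF v0] by (simp add: R_def)
  have "0 \<in> K" using R H by (simp add: K_def subspace_0)
  then have K: "compact K" "convex K" "K \<noteq> {}"
    using H compact_N_ball convex_N_ball unfolding K_def
    by (blast intro: closed_Int_compact closed_subspace convex_Int subspace_imp_convex)+
  define U where "U a = {h. N (a - t *\<^sub>R (h + v0)) < 1}" for a
  have "open (U a)" for a
    unfolding U_def by (intro open_Collect_less continuous_intros)
  moreover have "K \<subseteq> (\<Union>a\<in>{a\<in>H. N a = 1}. U a)"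
    using near by (auto simp: U_def)
  ultimately obtain A where A: "A \<subseteq> {a\<in>H. N a = 1}" "finite A" "K \<subseteq> (\<Union>a\<in>A. U a)"
    using compactE_image[OF K(1), of "{a\<in>H. N a = 1}" U] by metis
  define \<psi> where "\<psi> h a = max 0 (1 - N (a - t *\<^sub>R (h + v0)))" for h a
  define M where "M h = (\<Sum>a\<in>A. \<psi> h a *\<^sub>R a)" for h
  define \<sigma> where "\<sigma> h = (\<Sum>a\<in>A. \<psi> h a)" for h
  define P where "P h = {a\<in>A. h \<in> U a}" for h
  have contM: "continuous_on K M"
    unfolding M_def \<psi>_def by (intro continuous_intros)
  have MH: "M h \<in> H" for h
    unfolding M_def using A(1) H by (intro subspace_sum subspace_scale) auto
  have \<psi>_out: "\<psi> h a = 0" if "a \<in> A - P h" for h a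
    using that by (auto simp: P_def U_def \<psi>_def)
  have \<sigma>P: "\<sigma> h = (\<Sum>a\<in>P h. \<psi> h a)" and MP: "M h = (\<Sum>a\<in>P h. \<psi> h a *\<^sub>R a)" for h
    unfolding \<sigma>_def M_def using \<psi>_out[of _ h]
    by (intro sum.mono_neutral_right A(2); force simp: P_def)+
  have \<sigma>pos: "\<sigma> h > 0" if "h \<in> K" for h
    unfolding \<sigma>P
  proof (rule sum_pos)
    show "finite (P h)" using A(2) by (simp add: P_def)
    show "P h \<noteq> {}" using A(3) that by (auto simp: P_def)
    show "0 < \<psi> h a" if "a \<in> P h" for a using that by (auto simp: P_def U_def \<psi>_def)
  qed
  have hullM: "(1 / \<sigma> h) *\<^sub>R M h \<in> convex hull P h" if "h \<in> K" for h
  proof -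
    have "(\<Sum>a\<in>P h. (\<psi> h a / \<sigma> h) *\<^sub>R a) \<in> convex hull P h"
    proof (rule convex_sum)
      show "(\<Sum>a\<in>P h. \<psi> h a / \<sigma> h) = 1"
        using \<sigma>pos[OF that] by (simp add: \<sigma>P flip: sum_divide_distrib)
    qed (use \<sigma>pos[OF that] A(2) in \<open>auto simp: P_def hull_inc \<psi>_def intro!: divide_nonneg_pos\<close>)
    then show ?thesis by (simp add: MP scaleR_sum_right)
  qed
  \<comment> \<open>unit vectors that are all shortened by the same translation cannot surround the origin\<close>
  have escape: "0 \<notin> convex hull B"
    if "finite B" "\<forall>a\<in>B. N a = 1 \<and> N (a - t *\<^sub>R (h + v0)) < 1" for B h
    using sphere_escape[of B "t *\<^sub>R (h + v0)"] that by force
  have Pprop: "finite (P h)" "\<forall>a\<in>P h. N a = 1 \<and> N (a - t *\<^sub>R (h + v0)) < 1" for h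
    using A by (auto simp: P_def U_def)
  have M0: "M h \<noteq> 0" if "h \<in> K" for h
    using hullM[OF that] escape[OF Pprop] by auto
  define \<Psi> where "\<Psi> h = - ((R / N (M h)) *\<^sub>R M h)" for h
  have "continuous_on K \<Psi>"
    unfolding \<Psi>_def using M0 contM by (intro continuous_intros) auto
  moreover have "\<Psi> \<in> K \<rightarrow> K"
    using M0 R MH H by (auto simp: \<Psi>_def K_def scale subspace_scale subspace_neg)
  ultimately obtain h where h: "h \<in> K" "\<Psi> h = h"
    using brouwer[OF K] by blast
  have Nh: "N h = R"
    using M0[OF h(1)] R by (subst h(2)[symmetric]) (simp add: \<Psi>_def scale)
  \<comment> \<open>subtracting \<open>t h\<close> shortens \<open>b\<close> by \<open>t R = 2 t N v0\<close>, and \<open>t v0\<close> restores at most half of that\<close>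
  define b where "b = (1 / R) *\<^sub>R h"
  have b: "b \<in> H" "N b = 1" using h(1) Nh R H by (auto simp: b_def K_def scale subspace_scale)
  have "b - t *\<^sub>R (h + v0) = (1 - t * R) *\<^sub>R b - t *\<^sub>R v0"
    using R by (simp add: b_def algebra_simps)
  then have "N (b - t *\<^sub>R (h + v0)) \<le> \<bar>1 - t * R\<bar> * N b + \<bar>t\<bar> * N v0"
    using N_diff_le[of "(1 - t * R) *\<^sub>R b" "t *\<^sub>R v0"] by (simp add: scale)
  also have "\<dots> = 1 - t * N v0" using b t by (simp add: R_def)
  also have "\<dots> < 1" using t pos[OF v0] by simp
  finally have bn: "N (b - t *\<^sub>R (h + v0)) < 1" .
  have "0 \<in> convex hull (insert b (P h))"
  proof -
    define \<kappa> where "\<kappa> = \<sigma> h / N (M h)"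
    have \<kappa>: "\<kappa> > 0" using \<sigma>pos[OF h(1)] M0[OF h(1)] by (simp add: \<kappa>_def pos)
    have "b = - ((1 / N (M h)) *\<^sub>R M h)"
      using R by (subst b_def, subst h(2)[symmetric]) (simp add: \<Psi>_def)
    then have bM: "b = - (\<kappa> *\<^sub>R ((1 / \<sigma> h) *\<^sub>R M h))"
      using \<sigma>pos[OF h(1)] by (simp add: \<kappa>_def)
    have "(1 / (1 + \<kappa>)) *\<^sub>R b + (\<kappa> / (1 + \<kappa>)) *\<^sub>R ((1 / \<sigma> h) *\<^sub>R M h)
        \<in> convex hull (insert b (P h))"
    proof (rule convexD[OF convex_convex_hull])
      show "b \<in> convex hull insert b (P h)" by (simp add: hull_inc)
      show "(1 / \<sigma> h) *\<^sub>R M h \<in> convex hull insert b (P h)"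
        using hullM[OF h(1)] hull_mono[of "P h" "insert b (P h)" convex] by auto
    qed (use \<kappa> in \<open>auto simp: field_simps\<close>)
    moreover have "(1 / (1 + \<kappa>)) *\<^sub>R b + (\<kappa> / (1 + \<kappa>)) *\<^sub>R ((1 / \<sigma> h) *\<^sub>R M h) = 0"
      by (subst bM) simp
    ultimately show ?thesis by simp
  qed
  then show False using escape[of "insert b (P h)" h] Pprop[of h] b bn by auto
qed

text \<open>
  The vectors \<open>h\<close> found for \<open>t \<rightarrow> 0\<close> stay in a compact set, and a limit point of them works for all \<open>t\<close>
  at once, because by convexity a vector that is not shortened at \<open>t\<close> is not shortened beyond \<open>t\<close>.
\<close>
lemma orthogonal_complement_vector:
  assumes H: "subspace H" and v0: "v0 \<notin> H"
  shows "\<exists>v. v \<notin> H \<and> (\<forall>a\<in>H. \<forall>s. N a \<le> N (a + s *\<^sub>R v))"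
proof -
  have v0': "v0 \<noteq> 0" using assms subspace_0 by blast
  define R where "R = 2 * N v0"
  have R: "R > 0" using pos[OF v0'] by (simp add: R_def)
  define t where "t n = 1 / (R * (real n + 1))" for n
  have t: "0 < t n" "t n * (2 * N v0) \<le> 1" for n
    using R by (auto simp: t_def intro!: divide_pos_pos mult_pos_pos simp flip: R_def)
  obtain h where h: "\<And>n. h n \<in> H" "\<And>n. N (h n) \<le> R"
    "\<And>n a. a \<in> H \<Longrightarrow> N a = 1 \<Longrightarrow> 1 \<le> N (a - t n *\<^sub>R (h n + v0))"
    using approx_orthogonal[OF H v0' t] unfolding R_def by metis
  have "compact (H \<inter> {h. N h \<le> R})"
    using H compact_N_ball by (intro closed_Int_compact closed_subspace)
  then obtain l r where l: "l \<in> H" "strict_mono r" "(h \<circ> r) \<longlonglongrightarrow> l"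
    unfolding compact_def using h(1,2) by (metis (no_types, lifting) IntD1 IntI mem_Collect_eq)
  have tr: "(t \<circ> r) \<longlonglongrightarrow> 0"
  proof -
    have "t = (\<lambda>n. (1 / R) * inverse (real (Suc n)))"
      by (simp add: t_def field_simps fun_eq_iff)
    then have "t \<longlonglongrightarrow> 0"
      using tendsto_mult_right_zero[OF LIMSEQ_inverse_real_of_nat, of "1 / R"] by simp
    then show ?thesis using l(2) LIMSEQ_subseq_LIMSEQ by blast
  qed
  define v where "v = l + v0"
  have main: "1 \<le> N (a - s *\<^sub>R v)" if a: "a \<in> H" "N a = 1" and s: "s > 0" for a s
  proof -
    have "eventually (\<lambda>n. (t \<circ> r) n < s) sequentially"
      using tr s by (rule order_tendstoD(2))
    then have "eventually (\<lambda>n. 1 \<le> N (a - s *\<^sub>R ((h \<circ> r) n + v0))) sequentially"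
    proof eventually_elim
      case (elim n)
      define \<tau> w where "\<tau> = (t \<circ> r) n / s" and "w = (h \<circ> r) n + v0"
      \<comment> \<open>\<open>a - t w\<close> lies between \<open>a\<close>, of norm 1, and \<open>a - s w\<close>\<close>
      have \<tau>: "0 < \<tau>" "\<tau> < 1" using elim t(1)[of "r n"] s by (auto simp: \<tau>_def)
      have "a - (t \<circ> r) n *\<^sub>R w = (1 - \<tau>) *\<^sub>R a + \<tau> *\<^sub>R (a - s *\<^sub>R w)"
        using s by (simp add: \<tau>_def algebra_simps)
      then have "1 \<le> (1 - \<tau>) * N a + \<tau> * N (a - s *\<^sub>R w)"
        using h(3)[OF a, of "r n"] triangle[of "(1 - \<tau>) *\<^sub>R a" "\<tau> *\<^sub>R (a - s *\<^sub>R w)"] \<tau>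
        by (simp add: scale w_def)
      then show ?case using \<tau> a(2) by (simp add: w_def)
    qed
    moreover have "(\<lambda>n. N (a - s *\<^sub>R ((h \<circ> r) n + v0))) \<longlonglongrightarrow> N (a - s *\<^sub>R v)"
      unfolding v_def by (intro tendsto_intros l(3))
    ultimately show ?thesis
      using tendsto_lowerbound trivial_limit_sequentially by blast
  qed
  have "N a \<le> N (a + s *\<^sub>R v)" if a: "a \<in> H" for a s
  proof (cases "a = 0 \<or> s = 0")
    case False
    then have a0: "N a > 0" "s \<noteq> 0" using pos by auto
    define e where "e = - (sgn s / N a) *\<^sub>R a"
    have e: "e \<in> H" "N e = 1"
      using a H a0 by (auto simp: e_def scale subspace_scale subspace_neg abs_sgn_eq)
    have "1 \<le> N (e - (\<bar>s\<bar> / N a) *\<^sub>R v)"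
      using a0 by (intro main e) auto
    also have "e - (\<bar>s\<bar> / N a) *\<^sub>R v = (- sgn s / N a) *\<^sub>R (a + s *\<^sub>R v)"
      using a0 by (simp add: e_def algebra_simps abs_sgn)
    also have "N \<dots> = N (a + s *\<^sub>R v) / N a"
      using a0 by (simp add: scale abs_sgn_eq)
    finally show ?thesis using a0 by (simp add: field_simps)
  qed auto
  moreover have "v \<notin> H"
    using v0 l(1) H subspace_diff[of H v l] by (auto simp: v_def)
  ultimately show ?thesis by blast
qed

end

section \<open>A dense set of reflections\<close>

context norm_function
begin

text \<open>
  Smooth points are dense: move from \<open>a\<close> slightly inwards to \<open>p\<close>, and let \<open>b\<close> be the Euclidean-nearest point
  to \<open>p\<close> outside the open unit ball of \<open>N\<close>. A line through \<open>b\<close> that stays outside the unit ball cannot enter the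
  Euclidean ball around \<open>p\<close> that touches at \<open>b\<close>, so it is perpendicular to the radius \<open>n = b - p\<close>.
\<close>
lemma touching_ball:
  assumes a: "N a = 1" and \<delta>: "\<delta> > 0"
  obtains b n where "N b = 1" "dist b a < \<delta>" "b \<bullet> n \<noteq> 0"
    "\<And>v. (\<And>s. 1 \<le> N (b + s *\<^sub>R v)) \<Longrightarrow> v \<bullet> n = 0"
proof -
  have a0: "a \<noteq> 0" using a by auto
  define \<epsilon> where "\<epsilon> = min (1/2) (\<delta> / (3 * norm a))"
  have \<epsilon>: "0 < \<epsilon>" "\<epsilon> < 1" "\<epsilon> * norm a < \<delta> / 2"
  proof -
    show "0 < \<epsilon>" "\<epsilon> < 1" using \<delta> a0 by (auto simp: \<epsilon>_def)
    have "\<epsilon> * norm a \<le> \<delta> / (3 * norm a) * norm a"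
      unfolding \<epsilon>_def by (intro mult_right_mono) auto
    also have "\<dots> < \<delta> / 2" using \<delta> a0 by simp
    finally show "\<epsilon> * norm a < \<delta> / 2" .
  qed
  define p where "p = (1 - \<epsilon>) *\<^sub>R a"
  have Np: "N p = 1 - \<epsilon>" using a \<epsilon> by (simp add: p_def scale)
  have pa: "dist p a = \<epsilon> * norm a"
    using \<epsilon> by (simp add: p_def dist_norm algebra_simps)
  have "closed {x. 1 \<le> N x}" by (intro closed_Collect_le continuous_intros)
  moreover have "a \<in> {x. 1 \<le> N x}" using a by simp
  ultimately obtain b where b: "1 \<le> N b" and nearest: "\<And>y. 1 \<le> N y \<Longrightarrow> dist p b \<le> dist p y"
    using distance_attains_inf[of "{x. 1 \<le> N x}" p] by auto
  define n where "n = b - p"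
  have n0: "n \<noteq> 0" using b Np \<epsilon> by (auto simp: n_def)
  \<comment> \<open>the open Euclidean ball around \<open>p\<close> through \<open>b\<close> lies inside the unit ball of \<open>N\<close>\<close>
  have inside: "N x < 1" if "norm (x - p) < norm n" for x
    using nearest[of x] that by (force simp: n_def dist_norm norm_minus_commute)
  have Nb: "N b = 1"
  proof (rule ccontr)
    assume "N b \<noteq> 1"
    then have b1: "N b > 1" using b by simp
    have Nn: "N n > 0" using n0 pos by blast
    define \<eta> where "\<eta> = min (1/2) ((N b - 1) / N n)"
    have "\<eta> * N n \<le> (N b - 1) / N n * N n"
      unfolding \<eta>_def by (intro mult_right_mono) auto
    then have \<eta>: "0 < \<eta>" "\<eta> < 1" "\<eta> * N n \<le> N b - 1"
      using b1 Nn n0 by (auto simp: \<eta>_def)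
    have "norm (b - \<eta> *\<^sub>R n - p) = norm ((1 - \<eta>) *\<^sub>R n)" by (simp add: n_def algebra_simps)
    also have "\<dots> < norm n" using \<eta> n0 by simp
    finally have "N (b - \<eta> *\<^sub>R n) < 1" by (rule inside)
    then show False using N_triangle_diff[of b "\<eta> *\<^sub>R n"] triangle[of "b - \<eta> *\<^sub>R n" "\<eta> *\<^sub>R n"] \<eta>
      by (simp add: scale)
  qed
  have "dist b a \<le> dist p b + dist p a"
    using dist_triangle[of b a p] by (simp add: dist_commute)
  also have "\<dots> \<le> 2 * dist p a" using nearest[of a] a by simp
  also have "\<dots> < \<delta>" using \<epsilon> pa by simp
  finally have ba: "dist b a < \<delta>" .
  have bn: "b \<bullet> n \<noteq> 0"
  proof
    assume orth: "b \<bullet> n = 0"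
    \<comment> \<open>then moving from \<open>b\<close> by \<open>\<delta>'\<close> towards \<open>p\<close> and by \<open>2 \<delta>'\<close> outwards along \<open>b\<close> would enter the ball,
      although the norm does not drop below 1; \<open>\<delta>'\<close> minimizes the distance to \<open>p\<close>\<close>
    define \<delta>' where "\<delta>' = (norm n)\<^sup>2 / ((norm n)\<^sup>2 + 4 * (norm b)\<^sup>2)"
    have b0: "(norm b)\<^sup>2 > 0" using Nb by auto
    have n1: "(norm n)\<^sup>2 > 0" using n0 by simp
    have \<delta>': "0 < \<delta>'" "\<delta>' \<le> 1" "\<delta>' * ((norm n)\<^sup>2 + 4 * (norm b)\<^sup>2) = (norm n)\<^sup>2"
    proof -
      have "0 < A / (A + 4 * B)" "A / (A + 4 * B) \<le> 1" "A / (A + 4 * B) * (A + 4 * B) = A"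
        if "A > 0" "B > 0" for A B :: real
        using that by (auto intro!: divide_pos_pos)
      from this[OF n1 b0] show "0 < \<delta>'" "\<delta>' \<le> 1" "\<delta>' * ((norm n)\<^sup>2 + 4 * (norm b)\<^sup>2) = (norm n)\<^sup>2"
        unfolding \<delta>'_def by auto
    qed
    define x where "x = (1 + 2 * \<delta>') *\<^sub>R b - \<delta>' *\<^sub>R n"
    have "N n \<le> 2" using N_diff_le[of b p] Nb Np \<epsilon> by (simp add: n_def)
    then have "\<delta>' * N n \<le> \<delta>' * 2" using \<delta>' by (intro mult_left_mono) auto
    moreover have "1 + 2 * \<delta>' \<le> N x + \<delta>' * N n"
      using triangle[of x "\<delta>' *\<^sub>R n"] \<delta>'(1) Nb by (simp add: x_def scale)
    ultimately have "N x \<ge> 1" by linarith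
    then have "norm n \<le> norm (x - p)" using inside[of x] by fastforce
    then have "(norm n)\<^sup>2 \<le> (norm (x - p))\<^sup>2" by (simp add: power_mono)
    also have "x - p = (1 - \<delta>') *\<^sub>R n + (2 * \<delta>') *\<^sub>R b" by (simp add: x_def n_def algebra_simps)
    also have "(norm \<dots>)\<^sup>2 = (1 - \<delta>')\<^sup>2 * (norm n)\<^sup>2 + 4 * \<delta>'\<^sup>2 * (norm b)\<^sup>2"
      using orth unfolding power2_norm_eq_inner
      by (simp add: inner_add_left inner_add_right inner_commute[of n b] power2_eq_square)
    also have "\<dots> = (norm n)\<^sup>2 - 2 * \<delta>' * (norm n)\<^sup>2 + \<delta>' * (\<delta>' * ((norm n)\<^sup>2 + 4 * (norm b)\<^sup>2))"
      by (simp add: power2_eq_square algebra_simps)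
    also have "\<dots> = (norm n)\<^sup>2 - \<delta>' * (norm n)\<^sup>2"
      unfolding \<delta>'(3) by simp
    finally show False using mult_pos_pos[OF \<delta>'(1) n1] by simp
  qed
  have "v \<bullet> n = 0" if v: "\<And>s. 1 \<le> N (b + s *\<^sub>R v)" for v
  proof (rule ccontr)
    assume vn: "v \<bullet> n \<noteq> 0"
    then have vv: "v \<bullet> v > 0" by auto
    \<comment> \<open>the parameter of the point of the line that is nearest to \<open>p\<close>\<close>
    define s where "s = - (v \<bullet> n) / (v \<bullet> v)"
    have "norm n \<le> norm (n + s *\<^sub>R v)"
      using v[of s] inside[of "b + s *\<^sub>R v"] by (fastforce simp: n_def algebra_simps)
    then have "n \<bullet> n \<le> (n + s *\<^sub>R v) \<bullet> (n + s *\<^sub>R v)" by (simp add: norm_le)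
    also have "\<dots> = n \<bullet> n + 2 * s * (v \<bullet> n) + s\<^sup>2 * (v \<bullet> v)"
      by (simp add: inner_add_left inner_add_right inner_commute[of n v] power2_eq_square algebra_simps)
    also have "\<dots> = n \<bullet> n - (v \<bullet> n)\<^sup>2 / (v \<bullet> v)"
      using vn by (simp add: s_def power2_eq_square field_simps)
    finally have "(v \<bullet> n)\<^sup>2 / (v \<bullet> v) \<le> 0" by simp
    moreover have "(v \<bullet> n)\<^sup>2 / (v \<bullet> v) > 0" using vn vv by simp
    ultimately show False by simp
  qed
  then show ?thesis using that[OF Nb ba bn] by blast
qed

end

text \<open>
  On a partition into \<open>n\<close> equal pieces the increments of \<open>G\<close> are bounded by \<open>C / n\<close> times those of \<open>k\<close>, which
  telescope. This replaces the statement that a function with vanishing derivative is constant, for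
  a \<open>G\<close> that need not be differentiable.
\<close>
lemma constant_if_monotone_control:
  fixes G k :: "real \<Rightarrow> real"
  assumes "\<And>s t. \<lbrakk>0 \<le> s; s \<le> 1; 0 \<le> t; t \<le> 1\<rbrakk> \<Longrightarrow> G t - G s \<le> C * ((s - t) * (k s - k t))"
  shows "G 1 = G 0"
proof -
  define D where "D = \<bar>C * (k 1 - k 0)\<bar>"
  have step: "\<bar>G 1 - G 0\<bar> \<le> D / real (Suc n)" for n
  proof -
    define m where "m = real (Suc n)"
    have m: "m > 0" by (simp add: m_def)
    define p where "p i = real i / m" for i
    have p: "0 \<le> p i" "p i \<le> 1" if "i \<le> Suc n" for i
      using that m by (auto simp: p_def m_def field_simps)
    have pd: "p (Suc i) - p i = 1 / m" for i
      using m by (simp add: p_def field_simps)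
    have "\<bar>G (p (Suc i)) - G (p i)\<bar> \<le> C / m * (k (p (Suc i)) - k (p i))" if "i < Suc n" for i
    proof -
      have "G (p i) - G (p (Suc i)) \<le> C * ((p (Suc i) - p i) * (k (p (Suc i)) - k (p i)))"
        using p[of i] p[of "Suc i"] that by (intro assms) auto
      moreover have "G (p (Suc i)) - G (p i) \<le> C * ((p i - p (Suc i)) * (k (p i) - k (p (Suc i))))"
        using p[of i] p[of "Suc i"] that by (intro assms) auto
      moreover have "p i - p (Suc i) = - (1 / m)" using pd[of i] by simp
      ultimately show ?thesis by (simp add: pd algebra_simps)
    qed
    then have "(\<Sum>i<Suc n. \<bar>G (p (Suc i)) - G (p i)\<bar>) \<le> (\<Sum>i<Suc n. C / m * (k (p (Suc i)) - k (p i)))"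
      by (intro sum_mono) auto
    also have "\<dots> = C / m * (k (p (Suc n)) - k (p 0))"
      using sum_lessThan_telescope[of "\<lambda>i. k (p i)" "Suc n"] by (simp only: flip: sum_distrib_left)
    finally have "\<bar>\<Sum>i<Suc n. (G (p (Suc i)) - G (p i))\<bar> \<le> C / m * (k (p (Suc n)) - k (p 0))"
      by (rule order_trans[OF sum_abs])
    then have "\<bar>G (p (Suc n)) - G (p 0)\<bar> \<le> C / m * (k (p (Suc n)) - k (p 0))"
      using sum_lessThan_telescope[of "\<lambda>i. G (p i)" "Suc n"] by simp
    moreover have "p (Suc n) = 1" "p 0 = 0" using m by (auto simp: p_def m_def)
    ultimately have "\<bar>G 1 - G 0\<bar> \<le> C * (k 1 - k 0) / m" by simp
    also have "\<dots> \<le> D / m"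
      unfolding D_def using m by (intro divide_right_mono) auto
    finally show ?thesis by (simp add: m_def)
  qed
  have "(\<lambda>n. D / real (Suc n)) \<longlonglongrightarrow> 0"
    using tendsto_mult_right_zero[OF LIMSEQ_inverse_real_of_nat, of D] by (simp add: field_simps)
  then have "\<bar>G 1 - G 0\<bar> \<le> 0"
    using step by (intro LIMSEQ_le_const) auto
  then show ?thesis by simp
qed

context norm_function
begin

text \<open>
  The functional \<open>f\<close> at \<open>u\<close> supports the ball of \<open>N\<close> at \<open>u\<close>, and the last hypothesis says that its kernel also
  supports the level set of \<open>x \<mapsto> N (b + x)\<close> through every multiple of \<open>u\<close>. Follow the segment \<open>z\<close> from \<open>x\<close> to \<open>y\<close>, project it
  radially to the \<open>N\<close>-circle of radius \<open>c\<close>, and let \<open>G\<close> be the value of \<open>N (b + _)\<close> there. Comparing two parameters by means of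
  the support functionals bounds the change of \<open>G\<close> by the product of the increments of the
  parameter and of the slope \<open>k t = f t (y - x)\<close>, and \<open>constant_if_monotone_control\<close> applies.
\<close>
lemma level_curves_homothetic:
  assumes V: "subspace V"
    and supp: "\<And>u. u \<in> V \<Longrightarrow> u \<noteq> 0 \<Longrightarrow> \<exists>f. linear f \<and> f u = N u \<and> (\<forall>x\<in>V. f x \<le> N x) \<and>
       (\<forall>x\<in>V. N (b + (f x / N u) *\<^sub>R u) \<le> N (b + x))"
    and xy: "x \<in> V" "y \<in> V" "independent {x, y}" "x \<noteq> y"
  shows "N (b + (c / N x) *\<^sub>R x) = N (b + (c / N y) *\<^sub>R y)"
proof -
  define z where "z t = x + t *\<^sub>R (y - x)" for t :: real
  have zV: "z t \<in> V" for t
    using V xy by (simp add: z_def subspace_add subspace_diff subspace_scale)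
  have z0: "z t \<noteq> 0" for t
  proof
    assume "z t = 0"
    then have eq: "(1 - t) *\<^sub>R x + t *\<^sub>R y = 0" by (simp add: z_def algebra_simps)
    have "x \<noteq> 0" "y \<noteq> 0" using xy(3) dependent_zero by blast+
    moreover have "t = 0"
    proof (rule ccontr)
      assume "t \<noteq> 0"
      then have "y = (1 / t) *\<^sub>R (t *\<^sub>R y)" by simp
      also have "t *\<^sub>R y = - ((1 - t) *\<^sub>R x)" using eq by (simp add: add_eq_0_iff)
      finally have "y \<in> span {x}" by (metis span_base span_scale span_neg singletonI)
      moreover have "independent (insert y {x})" using xy(3) by (simp add: insert_commute)
      ultimately show False using xy(4) unfolding independent_insert by auto
    qed
    ultimately show False using eq by simp
  qed
  obtain f where f: "\<And>t. linear (f t)" "\<And>t. f t (z t) = N (z t)" "\<And>t w. w \<in> V \<Longrightarrow> f t w \<le> N w"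
    "\<And>t w. w \<in> V \<Longrightarrow> N (b + (f t w / N (z t)) *\<^sub>R z t) \<le> N (b + w)"
    using supp[OF zV z0] by metis
  obtain \<mu> where \<mu>: "\<mu> > 0" "\<And>t. t \<in> {0..1} \<Longrightarrow> \<mu> \<le> N (z t)"
  proof -
    have "continuous_on {0..1} (\<lambda>t. N (z t))" unfolding z_def by (intro continuous_intros)
    then obtain t0 where "\<forall>t\<in>{0..1}. N (z t0) \<le> N (z t)"
      using continuous_attains_inf[of "{0..1::real}" "\<lambda>t. N (z t)"] by auto
    then show ?thesis using that[of "N (z t0)"] pos[OF z0] by blast
  qed
  define G where "G t = N (b + (c / N (z t)) *\<^sub>R z t)" for t
  define k where "k t = f t (y - x)" for t
  have "G 1 = G 0"
  proof (rule constant_if_monotone_control[where C = "\<bar>c\<bar> / \<mu>" and k = k])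
    fix s t :: real assume st: "0 \<le> s" "s \<le> 1" "0 \<le> t" "t \<le> 1"
    have Ns: "N (z s) > 0" "N (z t) > 0" "\<mu> \<le> N (z s)" using pos[OF z0] \<mu>(2) st by auto
    have lt: "f t (r *\<^sub>R w) = r * f t w" for r w using f(1)[of t] by (simp add: linear_cmul)
    define \<theta> where "\<theta> = f t (z s) / N (z s)"
    have \<theta>: "\<theta> \<le> 1" using f(3)[OF zV, of t s] Ns by (simp add: \<theta>_def)
    have "b + (c * \<theta> / N (z t)) *\<^sub>R z t + (c * (1 - \<theta>) / N (z t)) *\<^sub>R z t = b + (c / N (z t)) *\<^sub>R z t"
      by (simp add: algebra_simps diff_divide_distrib)
    then have "G t \<le> N (b + (c * \<theta> / N (z t)) *\<^sub>R z t) + N ((c * (1 - \<theta>) / N (z t)) *\<^sub>R z t)"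
      unfolding G_def by (metis triangle)
    also have "N ((c * (1 - \<theta>) / N (z t)) *\<^sub>R z t) = \<bar>c\<bar> * (1 - \<theta>)"
      using \<theta> z0[of t] by (simp add: scale abs_mult)
    also have "N (b + (c * \<theta> / N (z t)) *\<^sub>R z t) \<le> G s"
      unfolding G_def using f(4)[of "(c / N (z s)) *\<^sub>R z s" t] zV V
      by (simp add: lt \<theta>_def subspace_scale)
    finally have "G t - G s \<le> \<bar>c\<bar> * (1 - \<theta>)" by simp
    also have "1 - \<theta> = (N (z s) - f t (z s)) / N (z s)"
      using z0[of s] by (simp add: \<theta>_def diff_divide_distrib)
    also have "\<dots> \<le> (N (z s) - f t (z s)) / \<mu>"
      using Ns \<mu>(1) f(3)[OF zV, of t s] by (intro divide_left_mono) auto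
    also have "N (z s) - f t (z s) \<le> (s - t) * (k s - k t)"
    proof -
      have zs: "z s = z t + (s - t) *\<^sub>R (y - x)" by (simp add: z_def algebra_simps)
      have "f r (z s) = f r (z t) + (s - t) * k r" if "r = s \<or> r = t" for r
        using f(1) by (subst zs) (auto simp: linear_add linear_cmul k_def that)
      from this[of s] this[of t] show ?thesis
        using f(2)[of s] f(2)[of t] f(3)[OF zV, of s t] by (simp add: algebra_simps)
    qed
    finally show "G t - G s \<le> \<bar>c\<bar> / \<mu> * ((s - t) * (k s - k t))"
      using \<mu>(1) by (simp add: mult_left_mono divide_right_mono)
  qed
  then show ?thesis by (simp add: G_def z_def)
qed

end

context chd_norm
begin

text \<open>
  The plane through \<open>b\<close> and \<open>u\<close> has an orthogonal direction \<open>v\<close>. It is orthogonal to \<open>b\<close> too, hence lies in the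
  tangent plane at \<open>b\<close>, which is therefore spanned by \<open>u\<close> and \<open>v\<close>; \<open>f\<close> is the coordinate along \<open>u\<close>.
\<close>
lemma support_in_tangent_plane:
  fixes b n :: 'e
  assumes dim3: "DIM('e) = 3" and b: "N b = 1" "b \<bullet> n \<noteq> 0"
    and tangent: "\<And>v. (\<And>s. 1 \<le> N (b + s *\<^sub>R v)) \<Longrightarrow> v \<bullet> n = 0"
    and u: "u \<bullet> n = 0" "u \<noteq> 0"
  obtains v f where "v \<bullet> n = 0" "\<And>k. v \<noteq> k *\<^sub>R u" "linear f" "f u = N u"
    "\<And>x. x \<bullet> n = 0 \<Longrightarrow> f x \<le> N x"
    "\<And>x. x \<bullet> n = 0 \<Longrightarrow> N (b + (f x / N u) *\<^sub>R u) \<le> N (b + x)"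
proof -
  define H where "H = span {b, u}"
  have bH: "b + k *\<^sub>R u \<in> H" "k *\<^sub>R u \<in> H" "b \<in> H" for k
    unfolding H_def by (intro span_add span_scale span_base; simp)+
  have "dim H \<le> card {b, u}" unfolding H_def by (rule dim_le_card) auto
  also have "\<dots> \<le> 2" by (simp add: card_insert_if)
  finally have "H \<noteq> UNIV" using dim3 by (metis dim_UNIV Suc_n_not_le_n eval_nat_numeral(3) numeral_2_eq_2)
  then obtain v0 where "v0 \<notin> H" by blast
  then obtain v where v: "v \<notin> H" "\<And>a s. a \<in> H \<Longrightarrow> N a \<le> N (a + s *\<^sub>R v)"
    using orthogonal_complement_vector[of H v0] by (auto simp: H_def)
  have vn: "v \<bullet> n = 0" using tangent v(2)[OF bH(3)] b by metis
  have vu: "v \<noteq> k *\<^sub>R u" for k using v(1) bH(2) by metis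
  have ind: "independent {u, v}" "u \<noteq> v" using independent_pair[OF u(2) vu] by auto
  have n0: "n \<noteq> 0" using b by auto
  have "{x. n \<bullet> x = 0} \<subseteq> span {u, v}"
    by (rule card_ge_dim_independent[OF _ ind(1)])
      (use u vn ind(2) dim_hyperplane[OF n0] dim3 in \<open>auto simp: inner_commute[of n]\<close>)
  then have rep: "\<exists>\<alpha> \<beta>. x = \<alpha> *\<^sub>R u + \<beta> *\<^sub>R v" if "x \<bullet> n = 0" for x
    using that by (force simp: inner_commute span_insert span_singleton algebra_simps)
  obtain f where f: "linear f" "f u = N u" "f v = 0"
    using linear_independent_extend[OF ind(1), of "\<lambda>x. if x = u then N u else 0"] ind(2) by auto
  show ?thesis
  proof (rule that[OF vn vu f(1,2)])
    fix x assume "x \<bullet> n = 0"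
    then obtain \<alpha> \<beta> where x: "x = \<alpha> *\<^sub>R u + \<beta> *\<^sub>R v" using rep by blast
    have fx: "f x = \<alpha> * N u" using f by (simp add: x linear_add linear_cmul)
    have "f x \<le> N (\<alpha> *\<^sub>R u)" by (simp add: fx scale mult_right_mono)
    also have "\<dots> \<le> N x" unfolding x by (rule v(2)[OF bH(2)])
    finally show "f x \<le> N x" .
    have "f x / N u = \<alpha>" using u by (simp add: fx)
    then show "N (b + (f x / N u) *\<^sub>R u) \<le> N (b + x)"
      using v(2)[OF bH(1), of \<alpha> \<beta>] by (simp add: x add.assoc)
  qed
qed

text \<open>
  A vector \<open>u\<close> of the tangent plane and its negative are compared through a third vector \<open>y\<close> of that plane,
  since the segment from \<open>u\<close> to \<open>-u\<close> passes through 0.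
\<close>
lemma reflection_near:
  fixes a :: 'e
  assumes dim3: "DIM('e) = 3" and a: "N a = 1" and \<delta>: "\<delta> > 0"
  obtains b F where "N b = 1" "dist b a < \<delta>" "F \<bullet> b = 1" "\<And>x. N ((2 * (F \<bullet> x)) *\<^sub>R b - x) = N x"
proof -
  obtain b n where b: "N b = 1" "dist b a < \<delta>" "b \<bullet> n \<noteq> 0"
    and tangent: "\<And>v. (\<And>s. 1 \<le> N (b + s *\<^sub>R v)) \<Longrightarrow> v \<bullet> n = 0"
    using touching_ball[OF a \<delta>] by metis
  define V where "V = {x. n \<bullet> x = 0}"
  have V: "subspace V" by (simp add: V_def subspace_hyperplane)
  have VI: "x \<in> V \<longleftrightarrow> x \<bullet> n = 0" for x by (simp add: V_def inner_commute)
  note supp = support_in_tangent_plane[OF dim3 b(1,3) tangent]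
  have homothetic: "N (b + (c / N x) *\<^sub>R x) = N (b + (c / N y) *\<^sub>R y)"
    if "x \<in> V" "y \<in> V" "independent {x, y}" "x \<noteq> y" for x y c
  proof (rule level_curves_homothetic[OF V _ that])
    fix u assume "u \<in> V" "u \<noteq> 0"
    then obtain v f where "linear f" "f u = N u" "\<And>x. x \<bullet> n = 0 \<Longrightarrow> f x \<le> N x"
      "\<And>x. x \<bullet> n = 0 \<Longrightarrow> N (b + (f x / N u) *\<^sub>R u) \<le> N (b + x)"
      using supp unfolding VI by metis
    then show "\<exists>f. linear f \<and> f u = N u \<and> (\<forall>x\<in>V. f x \<le> N x) \<and>
       (\<forall>x\<in>V. N (b + (f x / N u) *\<^sub>R u) \<le> N (b + x))"
      using VI by (intro exI[of _ f]) auto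
  qed
  have even: "N (b + u) = N (b - u)" if u: "u \<in> V" for u
  proof (cases "u = 0")
    case False
    then obtain y where y: "y \<in> V" "\<And>k. y \<noteq> k *\<^sub>R u"
      using supp u unfolding VI by metis
    have y': "y \<noteq> k *\<^sub>R (- u)" for k using y(2)[of "- k"] by simp
    have "N (b + (N u / N u) *\<^sub>R u) = N (b + (N u / N y) *\<^sub>R y)"
      using False u y independent_pair[of u y] by (intro homothetic) auto
    moreover have "N (b + (N u / N (- u)) *\<^sub>R (- u)) = N (b + (N u / N y) *\<^sub>R y)"
      using False u y(1) y' V independent_pair[of "- u" y] by (intro homothetic) (auto simp: subspace_neg)
    ultimately show ?thesis using False by simp
  qed simp
  define F where "F = (1 / (b \<bullet> n)) *\<^sub>R n"
  have "N ((2 * (F \<bullet> x)) *\<^sub>R b - x) = N x" for x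
  proof -
    define s u where "s = F \<bullet> x" and "u = x - s *\<^sub>R b"
    have u: "u \<in> V" using b(3)
      by (simp add: VI u_def s_def F_def inner_diff_left inner_commute[of n x])
    have x: "x = s *\<^sub>R b + u" by (simp add: u_def)
    have "N (s *\<^sub>R b - u) = N (s *\<^sub>R b + u)"
    proof (cases "s = 0")
      case False
      have "N (s *\<^sub>R b - u) = \<bar>s\<bar> * N (b - (1 / s) *\<^sub>R u)"
        using False by (simp flip: scale add: algebra_simps)
      also have "N (b - (1 / s) *\<^sub>R u) = N (b + (1 / s) *\<^sub>R u)"
        using even[of "(1 / s) *\<^sub>R u"] u V by (simp add: subspace_scale)
      also have "\<bar>s\<bar> * \<dots> = N (s *\<^sub>R b + u)"
        using False by (simp flip: scale add: algebra_simps)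
      finally show ?thesis .
    qed simp
    moreover have "(2 * (F \<bullet> x)) *\<^sub>R b - x = s *\<^sub>R b - u"
      by (simp add: u_def s_def algebra_simps flip: scaleR_add_left)
    ultimately show ?thesis using x by metis
  qed
  moreover have "F \<bullet> b = 1" using b(3) by (simp add: F_def inner_commute)
  ultimately show ?thesis using that b by blast
qed

text \<open>
  Reflections at touching points converge along a subsequence as these points approach \<open>a\<close>.
\<close>
lemma reflection_exists:
  fixes a :: 'e
  assumes dim3: "DIM('e) = 3" and a: "N a = 1"
  obtains F where "F \<bullet> a = 1" "\<And>x. N ((2 * (F \<bullet> x)) *\<^sub>R a - x) = N x"
proof -
  have "\<exists>b F. N b = 1 \<and> dist b a < 1 / Suc i \<and> F \<bullet> b = 1 \<and> (\<forall>x. N ((2 * (F \<bullet> x)) *\<^sub>R b - x) = N x)" for i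
    using reflection_near[OF dim3 a, of "1 / Suc i"] by (metis divide_pos_pos of_nat_0_less_iff zero_less_Suc zero_less_one)
  then obtain b F where bF: "\<And>i. N (b i) = 1" "\<And>i. dist (b i) a < 1 / Suc i" "\<And>i. F i \<bullet> b i = 1"
    "\<And>i x. N ((2 * (F i \<bullet> x)) *\<^sub>R b i - x) = N x" by metis
  obtain C where C: "\<And>b F. \<lbrakk>N b = 1; \<And>x. N ((2 * (F \<bullet> x)) *\<^sub>R b - x) = N x\<rbrakk> \<Longrightarrow> norm F \<le> C"
    using reflection_functional_bound by blast
  have "F i \<in> cball 0 C" for i using C[OF bF(1,4)] by simp
  then obtain G r where G: "strict_mono r" "(F \<circ> r) \<longlonglongrightarrow> G"
    using compact_cball[of "0::'e" C] unfolding compact_def by metis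
  have "b \<longlonglongrightarrow> a"
  proof (rule metric_LIMSEQ_I)
    fix e :: real assume "e > 0"
    then obtain M where M: "inverse (real (Suc M)) < e" using reals_Archimedean by blast
    have "dist (b i) a < e" if "i \<ge> M" for i
    proof -
      have "1 / real (Suc i) \<le> inverse (real (Suc M))" using that by (simp add: field_simps)
      then show ?thesis using bF(2)[of i] M by linarith
    qed
    then show "\<exists>no. \<forall>n\<ge>no. dist (b n) a < e" by blast
  qed
  then have b: "(b \<circ> r) \<longlonglongrightarrow> a" using G(1) LIMSEQ_subseq_LIMSEQ by blast
  have "(\<lambda>i. (F \<circ> r) i \<bullet> (b \<circ> r) i) \<longlonglongrightarrow> G \<bullet> a" by (intro tendsto_intros G b)
  then have 1: "G \<bullet> a = 1" using bF(3) by (simp add: LIMSEQ_const_iff)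
  have "(\<lambda>i. N ((2 * ((F \<circ> r) i \<bullet> x)) *\<^sub>R (b \<circ> r) i - x)) \<longlonglongrightarrow> N ((2 * (G \<bullet> x)) *\<^sub>R a - x)" for x
    by (intro tendsto_intros G b)
  then have "N ((2 * (G \<bullet> x)) *\<^sub>R a - x) = N x" for x using bF(4) by (simp add: LIMSEQ_const_iff)
  then show ?thesis using that 1 by blast
qed

end

section \<open>A reflection at every unit vector makes the norm Euclidean\<close>

context norm_function
begin

text \<open>
  The reflection fixes its axis \<open>a\<close> and negates the kernel of \<open>f\<close>; \<open>f\<close> is the coordinate along the axis.
\<close>
definition is_reflection :: "'e \<Rightarrow> ('e \<Rightarrow> real) \<Rightarrow> bool" where
  "is_reflection a f \<longleftrightarrow> linear f \<and> f a = 1 \<and> (\<forall>x. N ((2 * f x) *\<^sub>R a - x) = N x)"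

text \<open>
  Composing the two reflections gives the isometry \<open>x \<mapsto> x + 2 (f x - g x) a\<close>. It leaves \<open>f x - g x\<close> unchanged, so its
  iterates move \<open>x\<close> to infinity unless \<open>f x = g x\<close>.
\<close>
lemma reflection_unique:
  assumes "is_reflection a f" "is_reflection a g"
  shows "f x = g x"
proof (rule ccontr)
  assume ne: "f x \<noteq> g x"
  have lin: "linear f" "linear g" and one: "f a = 1" "g a = 1"
    and iso: "\<And>x. N ((2 * f x) *\<^sub>R a - x) = N x" "\<And>x. N ((2 * g x) *\<^sub>R a - x) = N x"
    using assms by (auto simp: is_reflection_def)
  define d where "d = 2 * (f x - g x)"
  have step: "N (z + d *\<^sub>R a) = N z" if z: "f z - g z = f x - g x" for z
  proof -
    define w where "w = (2 * f z) *\<^sub>R a - z"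
    have "g w = 2 * f z - g z" using lin one by (simp add: w_def linear_diff linear_cmul)
    then have "(2 * g w) *\<^sub>R a - w = z + (2 * (f z - g z)) *\<^sub>R a"
      by (simp add: w_def algebra_simps flip: scaleR_add_left)
    then have "z + d *\<^sub>R a = (2 * g w) *\<^sub>R a - w" using z by (simp add: d_def)
    then have "N (z + d *\<^sub>R a) = N w" by (simp only: iso)
    also have "\<dots> = N z" unfolding w_def by (rule iso)
    finally show ?thesis .
  qed
  have multi: "N (x + (real n * d) *\<^sub>R a) = N x" for n
  proof (induction n)
    case (Suc n)
    have "N (x + (real n * d) *\<^sub>R a + d *\<^sub>R a) = N (x + (real n * d) *\<^sub>R a)"
      using lin one by (intro step) (simp add: linear_add linear_cmul)
    then show ?case using Suc by (simp add: algebra_simps)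
  qed simp
  have a0: "N a > 0" using one lin linear_0 pos by (metis zero_neq_one)
  have d0: "\<bar>d\<bar> * N a > 0" using ne a0 by (simp add: d_def)
  obtain n :: nat where n: "2 * N x < real n * (\<bar>d\<bar> * N a)"
    using reals_Archimedean3[OF d0] by blast
  have "real n * (\<bar>d\<bar> * N a) \<le> N (x + (real n * d) *\<^sub>R a) + N x"
    using N_diff_le[of "x + (real n * d) *\<^sub>R a" x] by (simp add: scale abs_mult)
  then show False using n multi[of n] by simp
qed

end

text \<open>
  The vector \<open>F a\<close> represents the coordinate functional along \<open>a\<close> of the reflection at \<open>a\<close>. A vector, rather than a
  functional, makes continuity in \<open>a\<close> meaningful in a Euclidean space.
\<close>
locale reflection_norm = norm_function N for N :: "'e::euclidean_space \<Rightarrow> real" +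
  fixes F :: "'e \<Rightarrow> 'e"
  assumes reflection: "N a = 1 \<Longrightarrow> is_reflection a (\<lambda>x. F a \<bullet> x)"
begin

lemma F_self: "N a = 1 \<Longrightarrow> F a \<bullet> a = 1"
  and F_iso: "N a = 1 \<Longrightarrow> N ((2 * (F a \<bullet> x)) *\<^sub>R a - x) = N x"
  using reflection[of a] by (auto simp: is_reflection_def)

text \<open>
  The graph of \<open>F\<close> is closed, because by uniqueness it is cut out by the defining equations, and the
  values are bounded.
\<close>
lemma continuous_on_F: "continuous_on {a. N a = 1} F"
proof -
  obtain C where C: "\<And>b F. \<lbrakk>N b = 1; \<And>x. N ((2 * (F \<bullet> x)) *\<^sub>R b - x) = N x\<rbrakk> \<Longrightarrow> norm F \<le> C"
    using reflection_functional_bound by blast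
  have "F a \<in> cball 0 C" if "N a = 1" for a
    using C[OF that F_iso[OF that]] by simp
  moreover have "(\<lambda>a. (a, F a)) ` {a. N a = 1}
      = {p. N (fst p) = 1} \<inter> {p. snd p \<bullet> fst p = 1}
        \<inter> (\<Inter>x. {p. N ((2 * (snd p \<bullet> x)) *\<^sub>R fst p - x) = N x})" (is "?L = ?R")
  proof
    show "?L \<subseteq> ?R" using F_self F_iso by auto
    show "?R \<subseteq> ?L"
    proof
      fix p assume p: "p \<in> ?R"
      then have "is_reflection (fst p) (\<lambda>x. snd p \<bullet> x)"
        by (auto simp: is_reflection_def bounded_linear.linear bounded_linear_inner_right)
      then have "snd p \<bullet> x = F (fst p) \<bullet> x" for x
        using reflection_unique reflection p by blast
      then have "snd p = F (fst p)" using vector_eq_rdot by blast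
      then show "p \<in> ?L" using p by (auto simp: image_iff prod_eq_iff)
    qed
  qed
  moreover have "closed ?R"
    by (intro closed_Int closed_INT ballI closed_Collect_eq continuous_intros)
  ultimately show ?thesis
    by (intro continuous_from_closed_graph[OF compact_cball[of 0 C]]) auto
qed

text \<open>
  Let the axis \<open>a\<close> turn from \<open>x\<close> to \<open>y\<close> in the plane of the two. The coefficient of \<open>x\<close> in the reflected \<open>x\<close> goes
  from 1 to -1, so at some moment the image is a multiple of \<open>y\<close>, and of norm 1.
\<close>
lemma swap_isometry:
  assumes x: "N x = 1" and y: "N y = 1" and indep: "\<And>k. y \<noteq> k *\<^sub>R x"
  obtains a where "N a = 1" "(2 * (F a \<bullet> x)) *\<^sub>R a - x = y"
proof -
  have y0: "y \<noteq> 0" and x0: "x \<noteq> 0" using x y by auto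
  define z where "z t = (1 - t) *\<^sub>R x + t *\<^sub>R y" for t :: real
  have z0: "z t \<noteq> 0" for t
  proof
    assume "z t = 0"
    then have eq: "t *\<^sub>R y = - ((1 - t) *\<^sub>R x)" by (simp add: z_def add_eq_0_iff)
    have "t \<noteq> 0" using eq x0 by auto
    then have "y = (1 / t) *\<^sub>R (t *\<^sub>R y)" by simp
    also have "\<dots> = (- (1 / t * (1 - t))) *\<^sub>R x" unfolding eq by simp
    finally show False using indep by blast
  qed
  define a where "a t = (1 / N (z t)) *\<^sub>R z t" for t
  have Na: "N (a t) = 1" for t unfolding a_def by (rule N_normalize[OF z0])
  have cz: "continuous_on {0..1} z" unfolding z_def by (intro continuous_intros)
  have ca: "continuous_on {0..1} a" unfolding a_def
    by (intro continuous_intros cz) (use z0 in auto)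
  have cF: "continuous_on {0..1} (\<lambda>t. F (a t))"
    by (rule continuous_on_compose2[OF continuous_on_F ca]) (use Na in auto)
  define \<kappa> where "\<kappa> t = 2 * (F (a t) \<bullet> x) * ((1 - t) / N (z t)) - 1" for t
  have "continuous_on {0..1} \<kappa>" unfolding \<kappa>_def
    by (intro continuous_intros cz cF) (use z0 in auto)
  moreover have "\<kappa> 0 = 1" "\<kappa> 1 = -1"
    using x F_self[OF x] by (auto simp: \<kappa>_def a_def z_def)
  ultimately obtain t where t: "0 \<le> t" "t \<le> 1" "\<kappa> t = 0"
    using IVT2'[of \<kappa> 1 0 0] by auto
  have t': "0 < t" "t < 1"
    using t \<open>\<kappa> 0 = 1\<close> \<open>\<kappa> 1 = -1\<close> by (metis less_eq_real_def zero_neq_one zero_neq_neg_one)+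
  have Nz: "N (z t) > 0" using pos z0 by blast
  define \<beta> where "\<beta> = 2 * (F (a t) \<bullet> x) * (t / N (z t))"
  have "(2 * (F (a t) \<bullet> x)) *\<^sub>R a t - x = \<kappa> t *\<^sub>R x + \<beta> *\<^sub>R y"
  proof -
    have "c *\<^sub>R a t = (c * ((1 - t) / N (z t))) *\<^sub>R x + (c * (t / N (z t))) *\<^sub>R y" for c
      by (simp add: a_def z_def scaleR_add_right)
    then show ?thesis by (simp add: \<kappa>_def \<beta>_def scaleR_diff_left)
  qed
  then have R: "(2 * (F (a t) \<bullet> x)) *\<^sub>R a t - x = \<beta> *\<^sub>R y" using t(3) by simp
  have "\<bar>\<beta>\<bar> = 1" using F_iso[OF Na, of t x] x y unfolding R by (simp add: scale)
  moreover have "\<beta> > 0"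
  proof -
    have "2 * (F (a t) \<bullet> x) * ((1 - t) / N (z t)) > 0" using t(3) unfolding \<kappa>_def by linarith
    moreover have "(1 - t) / N (z t) > 0" using t' Nz by simp
    ultimately have "2 * (F (a t) \<bullet> x) > 0" using zero_less_mult_pos2 by blast
    then show ?thesis unfolding \<beta>_def using t' Nz by (intro mult_pos_pos[OF _ divide_pos_pos]) auto
  qed
  ultimately show ?thesis using that[OF Na, of t] R by simp
qed

text \<open>
  The swap \<open>R\<close> carries the reflection at \<open>y\<close> to a reflection at \<open>x\<close>, so \<open>F y \<bullet> R z = F x \<bullet> z\<close> for all \<open>z\<close>; take \<open>z = y\<close>.
\<close>
lemma F_symmetric:
  assumes x: "N x = 1" and y: "N y = 1"
  shows "F x \<bullet> y = F y \<bullet> x"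
proof (cases "\<exists>k. y = k *\<^sub>R x")
  case True
  then obtain k where k: "y = k *\<^sub>R x" by blast
  then have "\<bar>k\<bar> = 1" using x y by (simp add: scale)
  then have kk: "k * k = 1" by (metis abs_mult_self_eq mult_1)
  then have "x = k *\<^sub>R y" by (simp add: k)
  then have "F y \<bullet> x = k" using F_self[OF y] by (metis inner_scaleR_right mult.right_neutral)
  then show ?thesis using F_self[OF x] k by simp
next
  case False
  then obtain a where a: "N a = 1" and Rx: "(2 * (F a \<bullet> x)) *\<^sub>R a - x = y"
    using swap_isometry[OF x y] by blast
  define R where "R z = (2 * (F a \<bullet> z)) *\<^sub>R a - z" for z
  have RR: "R (R z) = z" for z
    using F_self[OF a] by (simp add: R_def inner_diff_right algebra_simps flip: scaleR_add_left)
  have linR: "linear R"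
    by (rule linearI) (auto simp: R_def inner_add_right algebra_simps)
  have NR: "N (R z) = N z" for z unfolding R_def by (rule F_iso[OF a])
  have Rxy: "R x = y" "R y = x" using Rx RR by (auto simp: R_def)
  have "is_reflection x (\<lambda>z. F y \<bullet> R z)"
    unfolding is_reflection_def
  proof (intro conjI allI)
    show "linear (\<lambda>z. F y \<bullet> R z)"
      using linear_compose[OF linR bounded_linear.linear[OF bounded_linear_inner_right[of "F y"]]]
      by (simp add: o_def)
    show "F y \<bullet> R x = 1" using F_self[OF y] Rxy by simp
    fix z
    have "R ((2 * (F y \<bullet> R z)) *\<^sub>R x - z) = (2 * (F y \<bullet> R z)) *\<^sub>R y - R z"
      using linR Rxy by (simp add: linear_diff linear_cmul)
    then have "N ((2 * (F y \<bullet> R z)) *\<^sub>R x - z) = N ((2 * (F y \<bullet> R z)) *\<^sub>R y - R z)"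
      using NR by metis
    then show "N ((2 * (F y \<bullet> R z)) *\<^sub>R x - z) = N z"
      using F_iso[OF y] NR by simp
  qed
  from reflection_unique[OF this reflection[OF x], of y] show ?thesis using Rxy by simp
qed

lemma inner_product_exists:
  "\<exists>B. bilinear B \<and> (\<forall>x y. B x y = B y x) \<and> (\<forall>x. B x x = (N x)\<^sup>2)"
proof -
  define B where "B x y = N x * (F ((1 / N x) *\<^sub>R x) \<bullet> y)" for x y
  have sym: "B x y = B y x" for x y
  proof (cases "x = 0 \<or> y = 0")
    case False
    define e d where "e = (1 / N x) *\<^sub>R x" and "d = (1 / N y) *\<^sub>R y"
    have ed: "N e = 1" "N d = 1" using False by (auto simp: e_def d_def N_normalize)
    have xy: "x = N x *\<^sub>R e" "y = N y *\<^sub>R d" using False by (auto simp: e_def d_def)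
    have "B x y = N x * N y * (F e \<bullet> d)"
      unfolding B_def e_def[symmetric] by (metis inner_scaleR_right mult.assoc xy(2))
    also have "\<dots> = N y * N x * (F d \<bullet> e)" using F_symmetric[OF ed] by simp
    also have "\<dots> = B y x"
      unfolding B_def d_def[symmetric] by (metis inner_scaleR_right mult.assoc xy(1))
    finally show ?thesis .
  qed (auto simp: B_def)
  have lin: "linear (B x)" for x
    by (rule linearI) (auto simp: B_def inner_add_right algebra_simps)
  have "linear (\<lambda>x. B x y)" for y using lin[of y] by (subst sym)
  then have "bilinear B" using lin by (simp add: bilinear_def)
  moreover have "B x x = (N x)\<^sup>2" for x
  proof (cases "x = 0")
    case False
    have "F ((1 / N x) *\<^sub>R x) \<bullet> (N x *\<^sub>R ((1 / N x) *\<^sub>R x)) = N x"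
      using F_self[OF N_normalize[OF False]] by (simp only: inner_scaleR_right)
    then show ?thesis using False by (simp add: B_def power2_eq_square)
  qed (simp add: B_def)
  ultimately show ?thesis using sym by blast
qed

end

lemma (in chd_norm) norm_is_euclidean:
  assumes "DIM('e) = 3"
  shows "\<exists>B. bilinear B \<and> (\<forall>x y. B x y = B y x) \<and> (\<forall>x. B x x = (N x)\<^sup>2)"
proof -
  have "\<exists>F. is_reflection a (\<lambda>x. F \<bullet> x)" if "N a = 1" for a
    using reflection_exists[OF assms that] unfolding is_reflection_def
    by (metis bounded_linear.linear bounded_linear_inner_right)
  then obtain F where "\<And>a. N a = 1 \<Longrightarrow> is_reflection a (\<lambda>x. F a \<bullet> x)" by metis
  then interpret reflection_norm N F by unfold_locales
  show ?thesis by (rule inner_product_exists)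
qed

section \<open>From three-dimensional subspaces to the whole space\<close>

lemma chd_norm_pullback:
  fixes \<phi> :: "'e::euclidean_space \<Rightarrow> 'a::real_normed_vector"
  assumes \<phi>: "linear \<phi>" "inj \<phi>" and chd: "chd_constant TYPE('a) \<le> 1"
  shows "chd_norm (\<lambda>x. norm (\<phi> x))"
proof
  fix x y :: 'e and c :: real
  show "norm (\<phi> (x + y)) \<le> norm (\<phi> x) + norm (\<phi> y)"
    using \<phi>(1) by (simp add: linear_add norm_triangle_ineq)
  show "norm (\<phi> (c *\<^sub>R x)) = \<bar>c\<bar> * norm (\<phi> x)"
    using \<phi>(1) by (simp add: linear_cmul)
  show "x \<noteq> 0 \<Longrightarrow> 0 < norm (\<phi> x)"
    using \<phi> linear_injective_0 by auto
next
  fix A :: "'e set" and w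
  assume A: "finite A" "0 \<in> convex hull A" "\<forall>a\<in>A. norm (\<phi> a) = 1"
  show "\<exists>a\<in>A. 1 \<le> norm (\<phi> (a - w))"
  proof (rule ccontr)
    assume "\<not> ?thesis"
    then have near: "norm (\<phi> (a - w)) < 1" if "a \<in> A" for a using that by force
    have ne: "A \<noteq> {}" using A(2) by auto
    \<comment> \<open>the value 1/2 only keeps \<open>\<rho>\<close> away from 0\<close>
    define \<rho> where "\<rho> = max (1/2) (Max ((\<lambda>a. norm (\<phi> (a - w))) ` A))"
    have \<rho>: "0 < \<rho>" "\<rho> < 1" using near A(1) ne by (auto simp: \<rho>_def)
    have \<rho>A: "norm (\<phi> (a - w)) \<le> \<rho>" if "a \<in> A" for a
      using that A(1) by (auto simp: \<rho>_def intro!: max.coboundedI2 Max_ge)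
    \<comment> \<open>blow the translated points up until they fill the unit ball\<close>
    define g where "g x = (1 / \<rho>) *\<^sub>R \<phi> x" for x
    have g: "linear g"
      unfolding g_def using \<phi>(1) by (simp add: linear_compose_scale_right)
    define D where "D = g ` ((\<lambda>a. - w + a) ` A)"
    have "- w \<in> convex hull ((\<lambda>a. - w + a) ` A)"
      unfolding convex_hull_translation using A(2) by force
    then have "g (- w) \<in> convex hull D"
      unfolding D_def convex_hull_linear_image[OF g, symmetric] by blast
    moreover have "D \<subseteq> cball 0 1"
    proof
      fix d assume "d \<in> D"
      then obtain a where a: "a \<in> A" "d = g (- w + a)" unfolding D_def by blast
      then show "d \<in> cball 0 1" using \<rho>A[OF a(1)] \<rho> by (simp add: g_def field_simps)
    qed
    moreover have "D \<noteq> {}" using ne by (simp add: D_def)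
    ultimately have "infdist (g (- w)) D \<le> 1"
      using infdist_le_chd_constant[of D "g (- w)"] chd by linarith
    moreover have "1 / \<rho> \<le> infdist (g (- w)) D"
    proof -
      have "1 / \<rho> \<le> dist (g (- w)) d" if d: "d \<in> D" for d
      proof -
        obtain a where a: "a \<in> A" "d = g (- w + a)" using d unfolding D_def by blast
        have "g (- w) - d = - g a" using linear_add[OF g, of "- w" a] a(2) by simp
        then have "dist (g (- w)) d = norm (g a)" by (simp add: dist_norm)
        also have "\<dots> = 1 / \<rho>" using A(3) a(1) \<rho> by (simp add: g_def)
        finally show ?thesis by simp
      qed
      then show ?thesis unfolding infdist_def using \<open>D \<noteq> {}\<close> by (auto intro!: cINF_greatest)
    qed
    moreover have "1 / \<rho> > 1" using \<rho> by simp
    ultimately show False by linarith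
  qed
qed

text \<open>
  Extend a maximal independent part of \<open>S\<close> to a basis of the whole space and keep three basis vectors. The
  dimension hypothesis is phrased to include infinite-dimensional spaces, where every basis is infinite.
\<close>
lemma three_dimensional_embedding:
  fixes S :: "'a::real_vector set"
  assumes S: "finite S" "card S \<le> 3"
    and B: "\<And>B :: 'a set. \<lbrakk>independent B; span B = UNIV; finite B\<rbrakk> \<Longrightarrow> 3 \<le> card B"
  obtains \<phi> :: "real^3 \<Rightarrow> 'a" where "linear \<phi>" "inj \<phi>" "S \<subseteq> range \<phi>"
proof -
  obtain T where T: "T \<subseteq> S" "independent T" "S \<subseteq> span T"
    using maximal_independent_subset by blast
  obtain B where B': "T \<subseteq> B" "independent B" "UNIV \<subseteq> span B"
    using maximal_independent_subset_extend[OF subset_UNIV T(2)] by metis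
  have finT: "finite T" using T(1) S(1) finite_subset by blast
  have cT: "card T \<le> 3" using card_mono[OF S(1) T(1)] S(2) by simp
  have "\<exists>C. T \<subseteq> C \<and> C \<subseteq> B \<and> card C = 3 \<and> finite C"
  proof (cases "finite B")
    case True
    then have "3 \<le> card B" using B B'(2,3) by (metis UNIV_I subsetI subset_antisym)
    then show ?thesis using exists_subset_between[OF cT _ B'(1) True] True
      by (metis finite_subset)
  next
    case False
    then obtain E where E: "E \<subseteq> B - T" "finite E" "card E = 3 - card T"
      using infinite_arbitrarily_large finT by (metis finite_Diff2)
    then have "card (T \<union> E) = 3" using cT finT by (subst card_Un_disjoint) auto
    then show ?thesis using E finT B'(1) by (intro exI[of _ "T \<union> E"]) auto
  qed
  then obtain C where C: "T \<subseteq> C" "C \<subseteq> B" "card C = 3" "finite C" by blast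
  have indC: "independent C" using independent_mono[OF B'(2) C(2)] .
  obtain e :: "3 \<Rightarrow> 'a" where e: "bij_betw e UNIV C"
    using finite_same_card_bij[of "UNIV :: 3 set" C] C by auto
  define \<phi> :: "real^3 \<Rightarrow> 'a" where "\<phi> z = (\<Sum>i\<in>UNIV. z $ i *\<^sub>R e i)" for z
  have lin: "linear \<phi>"
    by (rule linearI) (simp_all add: \<phi>_def scaleR_left_distrib sum.distrib scaleR_sum_right)
  have reindex: "(\<Sum>v\<in>C. h (inv_into UNIV e v) *\<^sub>R v) = (\<Sum>i\<in>UNIV. h i *\<^sub>R e i)" for h :: "3 \<Rightarrow> real"
    using e by (subst sum.reindex_bij_betw[OF e, symmetric]) (auto simp: bij_betw_def)
  have "inj \<phi>"
    unfolding linear_injective_0[OF lin]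
  proof (intro allI impI)
    fix z assume "\<phi> z = 0"
    then have "(\<Sum>v\<in>C. z $ (inv_into UNIV e v) *\<^sub>R v) = 0"
      using reindex[of "\<lambda>i. z $ i"] by (simp add: \<phi>_def)
    then have "z $ (inv_into UNIV e v) = 0" if "v \<in> C" for v
      using independentD[OF indC C(4) order_refl, of "\<lambda>v. z $ inv_into UNIV e v" v] that by blast
    then have "z $ i = 0" for i
      using e by (metis UNIV_I bij_betw_apply bij_betw_def inv_into_f_f)
    then show "z = 0" by (simp add: vec_eq_iff)
  qed
  moreover have "S \<subseteq> range \<phi>"
  proof -
    have "C \<subseteq> range \<phi>"
    proof
      fix v assume "v \<in> C"
      then obtain i where "v = e i" using e by (auto simp: bij_betw_def)
      then have "\<phi> (axis i 1) = v"
        by (simp add: \<phi>_def axis_def if_distrib[of "\<lambda>c. c *\<^sub>R _"] cong: if_cong)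
      then show "v \<in> range \<phi>" by blast
    qed
    then have "span C \<subseteq> range \<phi>"
      by (intro span_minimal linear_subspace_image[OF lin] subspace_UNIV)
    then show ?thesis using T(3) span_mono[OF C(1)] by blast
  qed
  ultimately show ?thesis using that lin by blast
qed

text \<open>
  The form is defined by polarization. Each of the identities that make it bilinear involves at
  most three vectors, so it can be checked in a subspace that contains them.
\<close>
lemma norm_from_inner_product_if_three_dimensional:
  assumes local_ip: "\<And>x y z :: 'a::real_normed_vector. \<exists>(\<phi> :: real^3 \<Rightarrow> 'a) B. linear \<phi> \<and> {x, y, z} \<subseteq> range \<phi> \<and>
     bilinear B \<and> (\<forall>u v. B u v = B v u) \<and> (\<forall>u. B u u = (norm (\<phi> u))\<^sup>2)"
  shows "norm_from_inner_product TYPE('a)"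
proof -
  define ip :: "'a \<Rightarrow> 'a \<Rightarrow> real" where "ip x y = ((norm (x + y))\<^sup>2 - (norm (x - y))\<^sup>2) / 4" for x y
  have rules: "ip (x + y) z = ip x z + ip y z \<and> ip (c *\<^sub>R x) z = c * ip x z" for x y z :: 'a and c :: real
  proof -
    obtain \<phi> :: "real^3 \<Rightarrow> 'a" and B where \<phi>: "linear \<phi>" and xyz: "{x, y, z} \<subseteq> range \<phi>" and bil: "bilinear B"
      and sym: "\<And>u v. B u v = B v u" and nrm: "\<And>u. B u u = (norm (\<phi> u))\<^sup>2"
      using local_ip[of x y z] by blast
    obtain p q r where pqr: "x = \<phi> p" "y = \<phi> q" "z = \<phi> r" using xyz by auto
    have ipB: "ip (\<phi> u) (\<phi> v) = B u v" for u v
    proof -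
      have "(norm (\<phi> u + \<phi> v))\<^sup>2 - (norm (\<phi> u - \<phi> v))\<^sup>2 = B (u + v) (u + v) - B (u - v) (u - v)"
        using \<phi> by (simp add: nrm linear_add linear_diff)
      also have "\<dots> = 4 * B u v"
        using bil sym[of v u] by (simp add: bilinear_ladd bilinear_radd bilinear_lsub bilinear_rsub)
      finally show ?thesis by (simp add: ip_def)
    qed
    have "ip (x + y) z = B (p + q) r" "ip (c *\<^sub>R x) z = B (c *\<^sub>R p) r"
      unfolding ipB[symmetric] pqr using \<phi> by (simp_all add: linear_add linear_cmul)
    then show ?thesis using bil by (simp add: pqr ipB bilinear_ladd bilinear_lmul)
  qed
  have sym: "ip x y = ip y x" for x y
    by (simp add: ip_def add.commute norm_minus_commute)
  have "linear (\<lambda>x. ip x y)" for y by (rule linearI) (use rules in auto)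
  moreover from this have "linear (ip x)" for x by (subst (asm) sym)
  ultimately have "bilinear ip" by (simp add: bilinear_def)
  moreover have "ip x x = (norm x)\<^sup>2" for x
    by (simp add: ip_def power2_eq_square flip: scaleR_2)
  ultimately show ?thesis
    unfolding norm_from_inner_product_def is_inner_product_def using sym
    by (intro exI[of _ ip]) auto
qed

lemma norm_from_inner_product_line:
  assumes "dim (UNIV :: 'a::real_normed_vector set) = 1"
  shows "norm_from_inner_product TYPE('a)"
proof -
  obtain B :: "'a set" where B: "independent B" "UNIV \<subseteq> span B" "card B = 1"
    using basis_exists[of "UNIV :: 'a set"] assms by metis
  obtain e where e: "B = {e}" using B(3) by (rule card_1_singletonE)
  have e0: "e \<noteq> 0" using B(1) e dependent_zero by blast
  have "\<exists>k. x = k *\<^sub>R e" for x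
    using B(2) e by (auto simp: span_singleton)
  then obtain r where r: "\<And>x. x = r x *\<^sub>R e" by metis
  have "r (x + y) = r x + r y" "r (c *\<^sub>R x) = c * r x" for x y c
  proof -
    have "r (x + y) *\<^sub>R e = (r x + r y) *\<^sub>R e" using r by (metis scaleR_left_distrib)
    then show "r (x + y) = r x + r y" using e0 by simp
    have "r (c *\<^sub>R x) *\<^sub>R e = (c * r x) *\<^sub>R e" using r by (metis scaleR_scaleR)
    then show "r (c *\<^sub>R x) = c * r x" using e0 by simp
  qed
  note r_lin = this
  define ip where "ip x y = r x * r y * (norm e)\<^sup>2" for x y
  have ip_self: "ip x x = (norm x)\<^sup>2" for x
    unfolding ip_def by (subst (3) r) (simp add: power_mult_distrib power2_eq_square)
  have "bilinear ip"
    unfolding bilinear_def by (intro conjI allI linearI) (auto simp: ip_def r_lin algebra_simps)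
  moreover have "ip x y = ip y x" for x y by (simp add: ip_def)
  ultimately show ?thesis
    unfolding norm_from_inner_product_def is_inner_product_def
    by (intro exI[of _ ip]) (auto simp: ip_self)
qed

theorem theorem3:
  assumes "(UNIV :: 'a::banach set) \<noteq> {0}"
  shows "chd_constant TYPE('a) = 1 \<longleftrightarrow>
    norm_from_inner_product TYPE('a) \<or> dim (UNIV :: 'a set) = 2"
proof
  assume "norm_from_inner_product TYPE('a) \<or> dim (UNIV :: 'a set) = 2"
  then have "chd_constant TYPE('a) \<le> 1"
    using chd_constant_euclidean chd_constant_plane by blast
  then show "chd_constant TYPE('a) = 1"
    using chd_constant_ge_1[OF assms] by simp
next
  assume chd: "chd_constant TYPE('a) = 1"
  consider "dim (UNIV :: 'a set) = 1" | "dim (UNIV :: 'a set) = 2"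
    | "dim (UNIV :: 'a set) \<noteq> 1" "dim (UNIV :: 'a set) \<noteq> 2" by blast
  then show "norm_from_inner_product TYPE('a) \<or> dim (UNIV :: 'a set) = 2"
  proof cases
    case 1
    then show ?thesis using norm_from_inner_product_line by blast
  next
    case 3
    have basis: "3 \<le> card B" if B: "independent B" "span B = UNIV" "finite B" for B :: "'a set"
    proof -
      have "card B = dim (UNIV :: 'a set)" using dim_eq_card[of B UNIV] B by simp
      moreover have "B \<noteq> {}" using B(2) assms by auto
      ultimately show ?thesis using 3 B(3) card_gt_0_iff[of B] by linarith
    qed
    have "norm_from_inner_product TYPE('a)"
    proof (rule norm_from_inner_product_if_three_dimensional)
      fix x y z :: 'a
      have "card {x, y, z} \<le> 3" by (simp add: card_insert_if)
      then obtain \<phi> :: "real^3 \<Rightarrow> 'a" where \<phi>: "linear \<phi>" "inj \<phi>" "{x, y, z} \<subseteq> range \<phi>"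
        using three_dimensional_embedding[of "{x, y, z}"] basis by blast
      interpret chd_norm "\<lambda>u. norm (\<phi> u)"
        using chd_norm_pullback[OF \<phi>(1,2)] chd by simp
      show "\<exists>(\<phi> :: real^3 \<Rightarrow> 'a) B. linear \<phi> \<and> {x, y, z} \<subseteq> range \<phi> \<and>
          bilinear B \<and> (\<forall>u v. B u v = B v u) \<and> (\<forall>u. B u u = (norm (\<phi> u))\<^sup>2)"
        using norm_is_euclidean \<phi>(1,3) by auto
    qed
    then show ?thesis by blast
  qed blast
qed

end
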